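(* Let a hyperelliptic curve of genus $g$ (in the canonical form described in the context) have all branch points real. For a subset $I\subseteq\{1,2,\dots,g\}$ put $\Omega(I)=\sum_{k\in I}\tfrac12\omega_k$ and $\mathfrak{U}_{\Im}(I)=\Omega(I)+\imath\,\mathbb{R}^g\subset\mathbb{C}^g$. Then among the $2^g$ affine subspaces $\mathfrak{U}_{\Im}(I)$, where $I$ runs over all subsets of $\{1,2,\dots,g\}$, there exists only one which contains no zeros of the sigma function. With the choice of cycles described in the context, this subspace corresponds to $\hat I=\{1,3,\dots,g\}$ if $g$ is odd, or $\hat I=\{2,4,\dots,g\}$ if $g$ is even, that is $$\Omega(\hat I)=\begin{cases}\sum_{k=1}^{\mathfrak{k}}\tfrac12\omega_{2k}, & g=2\mathfrak{k},\\[2pt] \sum_{k=1}^{\mathfrak{k}}\tfrac12\omega_{2k-1}, & g=2\mathfrak{k}-1,\end{cases}$$ and so $u\in\mathfrak{U}_{\Im}(\hat I)$ has the form $u=\imath s+\Omega(\hat I)$, $s\in\mathbb{R}^g$.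
   Context: The curve is non-degenerate, $y^2=\Lambda(x)=x^{2g+1}+\sum_{i=0}^{2g}\lambda_{2i+2}x^{2g-i}$, with real branch points (roots of $\Lambda$) $e_1<e_2<\dots<e_{2g+1}$. Cuts are made between $e_{2k-1}$ and $e_{2k}$, $k=1,\dots,g$, and from $e_{2g+1}$ to $\infty$; $\mathfrak{a}_k$ encircles the cut $(e_{2k-1},e_{2k})$, and $\mathfrak{b}_k$ emerges from the cut $(e_{2k-1},e_{2k})$ and enters the cut $(e_{2g+1},\infty)$. Differentials (with $\lambda_0=1$): $$\mathrm{d}u_{2n-1}=\frac{x^{g-n}\mathrm{d}x}{-2y},\qquad \mathrm{d}r_{2n-1}=\frac{\mathrm{d}x}{-2y}\sum_{j=0}^{2n-2}(2n-1-j)\lambda_{2j}x^{g+n-1-j},\qquad n=1,\dots,g,$$ $\mathrm{d}u=(\mathrm{d}u_1,\mathrm{d}u_3,\dots,\mathrm{d}u_{2g-1})^t$, $\mathrm{d}r=(\mathrm{d}r_1,\mathrm{d}r_3,\dots,\mathrm{d}r_{2g-1})^t$. The matrices $\omega,\omega',\eta$ have columns $$\omega_k=\oint_{\mathfrak{a}_k}\mathrm{d}u=2\int_{e_{2k-1}}^{e_{2k}}\mathrm{d}u,\quad \omega'_k=\oint_{\mathfrak{b}_k}\mathrm{d}u=2\sum_{i=k}^{g}\int_{e_{2i}}^{e_{2i+1}}\mathrm{d}u,\quad \eta_k=\oint_{\mathfrak{a}_k}\mathrm{d}r=2\int_{e_{2k-1}}^{e_{2k}}\mathrm{d}r,$$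 the integrals being along the real axis, with $y$ the boundary values from the upper half-plane of one fixed analytic branch of $\sqrt{\Lambda}$. Here $\omega$ is real and $\omega'$ purely imaginary; $\tau=\omega^{-1}\omega'$ is symmetric with $\operatorname{Im}\tau>0$; $\varkappa=\eta\omega^{-1}$ is symmetric. Theta function: $\theta(v;\tau)=\sum_{n\in\mathbb{Z}^g}\exp(\imath\pi n^t\tau n+2\imath\pi n^tv)$; with characteristic $[\varepsilon]=(\varepsilon',\varepsilon)^t$: $$\theta[\varepsilon](v;\tau)=\exp\big(\imath\pi(\varepsilon'^t/2)\tau(\varepsilon'/2)+2\imath\pi(v+\varepsilon/2)^t\varepsilon'/2\big)\,\theta(v+\varepsilon/2+\tau\varepsilon'/2;\tau).$$ The characteristic $[K]$ of the vector of Riemann constants is the sum modulo 2 of the characteristics of the branch points $e_{2k}$, $k=1,\dots,g$, where $e_{2k}$ corresponds to the half-period $\tfrac12\omega'_k+\sum_{i=1}^k\tfrac12\omega_i$, a half-period $\tfrac12\omega\varepsilon+\tfrac12\omega'\varepsilon'$ having characteristic $(\varepsilon',\varepsilon)^t$; thus $[K]$ has $\varepsilon'_k=1$ and $\varepsilon_k\equiv g-k+1\pmod 2$. The sigma function is the entire function $$\sigma(u)=C\exp\big(-\tfrac12u^t\varkappa u\big)\,\theta[K](\omega^{-1}u;\omega^{-1}\omega'),\qquad u\in\mathbb{C}^g,$$ with a nonzero constant $C$. *)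

theory Defs
  imports "HOL-Analysis.Analysis"
begin

text \<open>
  The genus is \<open>g = CARD('n)\<close>. The coordinates of vectors in \<open>\<complex>\<^sup>g\<close> and the rows and columns of
  matrices are numbered \<open>1, \<dots>, g\<close> along the linear order of the index type.
\<close>

definition idx :: "'n::{finite,linorder} \<Rightarrow> nat" where
  "idx i = card {..i}"

lemma idx_bij: "bij_betw (idx :: 'n::{finite,linorder} \<Rightarrow> nat) UNIV {1..CARD('n)}"
proof -
  have mono: "idx i < idx j" if "i < j" for i j :: 'n
    unfolding idx_def using that by (intro psubset_card_mono) auto
  have inj: "inj (idx :: 'n \<Rightarrow> nat)"
    by (rule injI) (metis mono less_irrefl linorder_neqE)
  have sub: "range (idx :: 'n \<Rightarrow> nat) \<subseteq> {1..CARD('n)}"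
  proof clarify
    fix i :: 'n
    have "card {..i} > 0" by (auto simp: card_gt_0_iff)
    moreover have "card {..i} \<le> CARD('n)" by (intro card_mono) auto
    ultimately show "idx i \<in> {1..CARD('n)}" by (simp add: idx_def Suc_le_eq)
  qed
  have "range (idx :: 'n \<Rightarrow> nat) = {1..CARD('n)}"
    using sub by (intro card_subset_eq) (auto simp: card_image inj)
  then show ?thesis using inj by (simp add: bij_betw_def)
qed

definition of_columns :: "(nat \<Rightarrow> complex^'n::{finite,linorder}) \<Rightarrow> complex^'n::{finite,linorder}^'n::{finite,linorder}" where
  "of_columns f = (\<chi> i k. f (idx k) $ i)"

definition Lambda :: "nat \<Rightarrow> (nat \<Rightarrow> complex) \<Rightarrow> complex \<Rightarrow> complex" where
  "Lambda g lam x = x ^ (2*g+1) + (\<Sum>i=0..2*g. lam (2*i+2) * x ^ (2*g-i))"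

text \<open>Only the values of \<open>lam\<close> at even numbers, and of \<open>e\<close> on \<open>{1..2*g+1}\<close>, are used.\<close>

definition real_hyperelliptic :: "nat \<Rightarrow> (nat \<Rightarrow> complex) \<Rightarrow> (nat \<Rightarrow> real) \<Rightarrow> bool" where
  "real_hyperelliptic g lam e \<longleftrightarrow>
     lam 0 = 1 \<and>
     strict_mono_on {1..2*g+1} e \<and>
     {x. Lambda g lam x = 0} = (\<lambda>i. complex_of_real (e i)) ` {1..2*g+1}"

definition sqrt_branch :: "nat \<Rightarrow> (nat \<Rightarrow> complex) \<Rightarrow> (complex \<Rightarrow> complex) \<Rightarrow> bool" where
  "sqrt_branch g lam Y \<longleftrightarrow>
     Y holomorphic_on {z. Im z > 0} \<and> (\<forall>z. Im z > 0 \<longrightarrow> (Y z)\<^sup>2 = Lambda g lam z)"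

definition bdry :: "(complex \<Rightarrow> complex) \<Rightarrow> real \<Rightarrow> complex" where
  "bdry Y x = Lim (at (complex_of_real x) within {z. Im z > 0}) Y"

text \<open>
  Coefficients with respect to \<open>dx\<close> of the two vectors of differentials, restricted to the real
  axis. At a branch point \<open>y = 0\<close>, and division by zero yields \<open>0\<close> there; this affects no integral.
\<close>

definition du :: "(complex \<Rightarrow> complex) \<Rightarrow> real \<Rightarrow> complex^'n::{finite,linorder}" where
  "du Y x = (\<chi> i. complex_of_real x ^ (CARD('n) - idx i) / (-2 * bdry Y x))"

definition dr ::
  "(nat \<Rightarrow> complex) \<Rightarrow> (complex \<Rightarrow> complex) \<Rightarrow> real \<Rightarrow> complex^'n::{finite,linorder}" where
  "dr lam Y x = (\<chi> i. 1 / (-2 * bdry Y x) *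
     (\<Sum>j=0..2 * idx i - 2. of_nat (2 * idx i - 1 - j) * lam (2*j) *
         complex_of_real x ^ (CARD('n) + idx i - 1 - j)))"

definition omega :: "(nat \<Rightarrow> real) \<Rightarrow> (complex \<Rightarrow> complex) \<Rightarrow> nat \<Rightarrow> complex^'n::{finite,linorder}" where
  "omega e Y k = 2 *s integral {e (2*k-1)..e (2*k)} (du Y)"

definition omega' :: "(nat \<Rightarrow> real) \<Rightarrow> (complex \<Rightarrow> complex) \<Rightarrow> nat \<Rightarrow> complex^'n::{finite,linorder}" where
  "omega' e Y k = 2 *s (\<Sum>i=k..CARD('n). integral {e (2*i)..e (2*i+1)} (du Y))"

definition eta ::
  "(nat \<Rightarrow> complex) \<Rightarrow> (nat \<Rightarrow> real) \<Rightarrow> (complex \<Rightarrow> complex) \<Rightarrow> nat \<Rightarrow> complex^'n::{finite,linorder}" where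
  "eta lam e Y k = 2 *s integral {e (2*k-1)..e (2*k)} (dr lam Y)"

definition tau :: "(nat \<Rightarrow> real) \<Rightarrow> (complex \<Rightarrow> complex) \<Rightarrow> complex^'n::{finite,linorder}^'n::{finite,linorder}" where
  "tau e Y = matrix_inv (of_columns (omega e Y)) ** of_columns (omega' e Y)"

definition varkappa ::
  "(nat \<Rightarrow> complex) \<Rightarrow> (nat \<Rightarrow> real) \<Rightarrow> (complex \<Rightarrow> complex) \<Rightarrow> complex^'n::{finite,linorder}^'n::{finite,linorder}" where
  "varkappa lam e Y = of_columns (eta lam e Y) ** matrix_inv (of_columns (omega e Y))"

definition cvec :: "int^'n \<Rightarrow> complex^'n" where
  "cvec m = (\<chi> i. of_int (m $ i))"

text \<open>\<open>scalar_product\<close> is the bilinear product \<open>a\<^sup>t b\<close>, without complex conjugation.\<close>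

definition theta :: "complex^'n \<Rightarrow> complex^'n^'n \<Rightarrow> complex" where
  "theta v T = (\<Sum>\<^sub>\<infinity>m\<in>(UNIV :: (int^'n) set).
      exp (\<i> * of_real pi * scalar_product (cvec m) (T *v cvec m)
         + 2 * \<i> * of_real pi * scalar_product (cvec m) v))"

definition theta_char :: "int^'n \<Rightarrow> int^'n \<Rightarrow> complex^'n \<Rightarrow> complex^'n^'n \<Rightarrow> complex" where
  "theta_char eps' eps v T =
     (let a = (1/2) *s cvec eps'; b = (1/2) *s cvec eps in
      exp (\<i> * of_real pi * scalar_product a (T *v a)
         + 2 * \<i> * of_real pi * scalar_product (v + b) a)
      * theta (v + b + T *v a) T)"

text \<open>
  The pair \<open>(bp_char' k, bp_char k)\<close> is the characteristic of the branch point \<open>e (2*k)\<close>, read off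
  from its half-period; see lemma \<open>bp_char_half_period\<close>.
\<close>

definition bp_char' :: "nat \<Rightarrow> int^'n::{finite,linorder}" where
  "bp_char' k = (\<chi> i. if idx i = k then 1 else 0)"

definition bp_char :: "nat \<Rightarrow> int^'n::{finite,linorder}" where
  "bp_char k = (\<chi> i. if idx i \<le> k then 1 else 0)"

definition K_char' :: "int^'n::{finite,linorder}" where
  "K_char' = (\<chi> i. (\<Sum>k=1..CARD('n). bp_char' k $ i) mod 2)"

definition K_char :: "int^'n::{finite,linorder}" where
  "K_char = (\<chi> i. (\<Sum>k=1..CARD('n). bp_char k $ i) mod 2)"

definition sigma_fun ::
  "(nat \<Rightarrow> complex) \<Rightarrow> (nat \<Rightarrow> real) \<Rightarrow> (complex \<Rightarrow> complex) \<Rightarrow> complex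
     \<Rightarrow> complex^'n::{finite,linorder} \<Rightarrow> complex" where
  "sigma_fun lam e Y C u =
     C * exp (- (1/2) * scalar_product u (varkappa lam e Y *v u))
       * theta_char K_char' K_char (matrix_inv (of_columns (omega e Y)) *v u) (tau e Y)"

definition Omega :: "(nat \<Rightarrow> real) \<Rightarrow> (complex \<Rightarrow> complex) \<Rightarrow> nat set \<Rightarrow> complex^'n::{finite,linorder}" where
  "Omega e Y I = (\<Sum>k\<in>I. (1/2) *s omega e Y k)"

definition imag_vec :: "real^'n \<Rightarrow> complex^'n" where
  "imag_vec s = (\<chi> i. \<i> * complex_of_real (s $ i))"

definition U_Im :: "(nat \<Rightarrow> real) \<Rightarrow> (complex \<Rightarrow> complex) \<Rightarrow> nat set \<Rightarrow> (complex^'n::{finite,linorder}) set" where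
  "U_Im e Y I = {Omega e Y I + imag_vec s | s. True}"

definition I_hat :: "nat \<Rightarrow> nat set" where
  "I_hat g = (if odd g then {k \<in> {1..g}. odd k} else {k \<in> {1..g}. even k})"

lemma sum_idx:
  "(\<Sum>i\<in>UNIV. f (idx (i :: 'n::{finite,linorder}))) = (\<Sum>k=1..CARD('n). f k)"
  using sum.reindex_bij_betw[OF idx_bij] .

lemma bp_char_half_period:
  fixes w w' :: "nat \<Rightarrow> complex^'n::{finite,linorder}"
  assumes "k \<in> {1..CARD('n)}"
  shows "(1/2) *s (of_columns w *v cvec (bp_char k)) + (1/2) *s (of_columns w' *v cvec (bp_char' k))
       = (1/2) *s w' k + (\<Sum>i=1..k. (1/2) *s w i)"
proof -
  have eq: "{1..CARD('n)} \<inter> {i. i \<le> k} = {1..k}" using assms by auto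
  have 1: "(of_columns w *v cvec (bp_char k)) $ j = (\<Sum>i=1..k. w i $ j)" for j
  proof -
    have "(of_columns w *v cvec (bp_char k)) $ j
        = (\<Sum>i\<in>UNIV. (\<lambda>m. if m \<le> k then w m $ j else 0) (idx (i :: 'n)))"
      unfolding matrix_vector_mult_def of_columns_def cvec_def bp_char_def
      by (auto intro!: sum.cong)
    also have "\<dots> = (\<Sum>m=1..CARD('n). if m \<le> k then w m $ j else 0)"
      by (rule sum_idx)
    also have "\<dots> = (\<Sum>i=1..k. w i $ j)"
      using eq by (simp add: sum.If_cases)
    finally show ?thesis .
  qed
  have 2: "(of_columns w' *v cvec (bp_char' k)) $ j = w' k $ j" for j
  proof -
    have "(of_columns w' *v cvec (bp_char' k)) $ j
        = (\<Sum>i\<in>UNIV. (\<lambda>m. if m = k then w' m $ j else 0) (idx (i :: 'n)))"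
      unfolding matrix_vector_mult_def of_columns_def cvec_def bp_char'_def
      by (auto intro!: sum.cong)
    also have "\<dots> = (\<Sum>m=1..CARD('n). if m = k then w' m $ j else 0)"
      by (rule sum_idx)
    also have "\<dots> = w' k $ j"
      using assms by simp
    finally show ?thesis .
  qed
  show ?thesis
    by (simp add: vec_eq_iff 1 2 sum_divide_distrib add.commute)
qed

lemma K_char'_nth: "K_char' $ (i :: 'n::{finite,linorder}) = 1"
proof -
  have "idx i \<in> {1..CARD('n)}" using idx_bij[where 'n='n] by (auto simp: bij_betw_def)
  then show ?thesis by (simp add: K_char'_def bp_char'_def)
qed

lemma K_char_nth: "K_char $ (i :: 'n::{finite,linorder}) = int (CARD('n) - idx i + 1) mod 2"
proof -
  have m: "idx i \<in> {1..CARD('n)}" using idx_bij[where 'n='n] by (auto simp: bij_betw_def)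
  then have "{1..CARD('n)} \<inter> {k. idx i \<le> k} = {idx i..CARD('n)}" by auto
  then show ?thesis using m
    by (simp add: K_char_def bp_char_def sum.If_cases Suc_diff_le)
qed

end

theory Submission
  imports Defs "HOL-Complex_Analysis.Cauchy_Integral_Theorem"
begin

text \<open>
  On \<open>\<Omega>(I) + \<i> \<real>\<^sup>g\<close> the sigma function is, up to a non-vanishing factor, a real theta series
  \<open>\<Sum>\<^sub>m (-1)\<^bsup>m\<cdot>d\<^esup> exp (-\<pi> m\<cdot>S m - 2\<pi> m\<cdot>r)\<close> with \<open>S = \<tau> / \<i>\<close>, \<open>r \<in> \<real>\<^sup>g\<close>, where \<open>d\<close> is the sum of the
  indicator vector of \<open>I\<close> and the characteristic of the vector of Riemann constants. If \<open>d\<close> is even, all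
  terms are positive. If some \<open>d\<^sub>j\<close> is odd, quasi-periodicity makes the series change sign, so it
  vanishes somewhere. Hence the only good \<open>I\<close> is the one congruent to the characteristic.

  What has to be known about the periods is only that \<open>\<omega>\<close> is real and invertible, that \<open>\<omega>'\<close> is
  purely imaginary, and that \<open>m\<cdot>S m > 0\<close> for real \<open>m \<noteq> 0\<close>; the symmetry of \<open>\<tau>\<close> plays no role, since
  the theta series sees only the symmetric part of \<open>S\<close> and \<open>r\<close> ranges over all of \<open>\<real>\<^sup>g\<close>. The
  positivity is obtained without a two-dimensional integral. Choose the basis of differentials
  \<open>p\<^sub>k\<close> with cut integrals \<open>1\<close> on cut \<open>k\<close>, \<open>-1\<close> on cut \<open>k + 1\<close> and \<open>0\<close> on the others. The integral of
  such a form along the real axis is zero, by Cauchy's theorem in the upper half-plane, so that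
  its numerator, of degree less than \<open>g\<close>, has one root in each remaining cut, the infinite one included, and
  therefore all signs of its gap integrals are known. In this basis the period form is a matrix with
  nonpositive off-diagonal entries, positive row sums and nonnegative column sums, which is
  positive definite.
\<close>

section \<open>Theta functions with half-integer characteristics and purely imaginary period matrix\<close>

definition rvec :: "int^'n \<Rightarrow> real^'n" where
  "rvec m = (\<chi> i. real_of_int (m $ i))"

text \<open>\<open>(-1)^k\<close> for an integer \<open>k\<close> that may be negative, where a
  power would need a natural exponent.\<close>

definition parity_sign :: "int \<Rightarrow> real" where
  "parity_sign k = (if even k then 1 else -1)"

lemma exp_pi_i_int: "exp (\<i> * of_real pi * of_int k) = of_real (parity_sign k)"
proof -
  have "exp (\<i> * of_real pi * of_int k) = cis (pi * of_int k)"
    by (simp add: cis_conv_exp mult_ac)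
  also have "\<dots> = of_real (parity_sign k)"
    by (simp add: complex_eq_iff cos_npi_int parity_sign_def)
  finally show ?thesis .
qed

section \<open>Gaussian majorants for sums over the integer lattice\<close>

lemma summable_on_exp_abs_int: "(\<lambda>k::int. exp (- real_of_int \<bar>k\<bar>)) summable_on UNIV"
proof -
  have "summable (\<lambda>n. exp (-1 :: real) ^ n)" by (rule summable_geometric) simp
  then have n: "(\<lambda>n. exp (- real n)) summable_on UNIV"
    by (intro summable_nonneg_imp_summable_on) (auto simp: exp_of_nat_mult [symmetric])
  have "(\<lambda>k::int. exp (- real_of_int \<bar>k\<bar>)) summable_on (range int)"
    using n by (subst summable_on_reindex) (auto simp: o_def)
  moreover have "(\<lambda>k::int. exp (- real_of_int \<bar>k\<bar>)) summable_on (range (\<lambda>n. - int n))"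
    using n by (subst summable_on_reindex) (auto simp: o_def inj_on_def)
  moreover have "(UNIV :: int set) = range int \<union> range (\<lambda>n. - int n)"
    by (auto simp: image_iff) (metis int_cases2)
  ultimately show ?thesis
    by (metis summable_on_union)
qed

lemma summable_on_gaussian_int:
  fixes a b :: real
  assumes "a > 0"
  shows "(\<lambda>k::int. exp (- a * (real_of_int k)\<^sup>2 + b * \<bar>real_of_int k\<bar>)) summable_on UNIV"
proof (rule summable_on_comparison_test)
  \<comment> \<open>\<open>C\<close> is the maximum of \<open>- a * x\<^sup>2 + (b + 1) * x\<close>;
    the extra unit of \<open>x\<close> leaves the summable factor \<open>exp (- x)\<close>.\<close>
  define C where "C = (b + 1)\<^sup>2 / (4 * a)"
  show "(\<lambda>k::int. exp C * exp (- real_of_int \<bar>k\<bar>)) summable_on UNIV"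
    by (intro summable_on_cmult_right summable_on_exp_abs_int)
  fix k :: int
  define x where "x = \<bar>real_of_int k\<bar>"
  have "4 * a * (C - x - (- a * x\<^sup>2 + b * x)) = (2 * a * x - (b + 1))\<^sup>2"
    using assms by (simp add: C_def right_diff_distrib) (simp add: power2_eq_square algebra_simps)
  then have "4 * a * (C - x - (- a * x\<^sup>2 + b * x)) \<ge> 0"
    by simp
  then have "C - x - (- a * x\<^sup>2 + b * x) \<ge> 0"
    using assms by (simp add: zero_le_mult_iff)
  then show "exp (- a * (real_of_int k)\<^sup>2 + b * \<bar>real_of_int k\<bar>) \<le> exp C * exp (- real_of_int \<bar>k\<bar>)"
    by (simp add: x_def flip: exp_add)
qed simp

text \<open>A finite set of vectors lies in the box spanned by its coordinate projections, and the
  sum over a box factorises into one-dimensional sums.\<close>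

lemma summable_on_prod_vec:
  fixes f :: "'a \<Rightarrow> real"
  assumes f: "f summable_on UNIV" and nonneg: "\<And>k. f k \<ge> 0"
  shows "(\<lambda>m::'a^'n. \<Prod>i\<in>UNIV. f (m $ i)) summable_on UNIV"
proof (rule nonneg_bdd_above_summable_on)
  show "bdd_above (sum (\<lambda>m::'a^'n. \<Prod>i\<in>UNIV. f (m $ i)) ` {F. F \<subseteq> UNIV \<and> finite F})"
  proof (rule bdd_aboveI2)
    fix F :: "('a^'n) set" assume "F \<in> {F. F \<subseteq> UNIV \<and> finite F}"
    then have fin: "finite F" by simp
    define B where "B i = (\<lambda>m. m $ i) ` F" for i
    have inj: "inj_on vec_nth F" by (auto simp: inj_on_def vec_eq_iff)
    have "(\<Sum>m\<in>F. \<Prod>i\<in>UNIV. f (m $ i)) = (\<Sum>g\<in>vec_nth ` F. \<Prod>i\<in>UNIV. f (g i))"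
      by (simp add: sum.reindex[OF inj])
    also have "\<dots> \<le> (\<Sum>g\<in>PiE UNIV B. \<Prod>i\<in>UNIV. f (g i))"
      using fin nonneg by (intro sum_mono2 finite_PiE) (auto simp: B_def prod_nonneg)
    also have "\<dots> = (\<Prod>i\<in>UNIV. \<Sum>k\<in>B i. f k)"
      using fin by (intro prod_sum_PiE [symmetric]) (auto simp: B_def)
    also have "\<dots> \<le> (\<Prod>i\<in>(UNIV::'n set). infsum f UNIV)"
      using fin nonneg f by (intro prod_mono conjI sum_nonneg finite_sum_le_infsum) (auto simp: B_def)
    finally show "(\<Sum>m\<in>F. \<Prod>i\<in>UNIV. f (m $ i)) \<le> (\<Prod>i\<in>(UNIV::'n set). infsum f UNIV)" .
  qed
qed (auto simp: nonneg prod_nonneg)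

text \<open>The form attains a positive minimum on the compact unit sphere and is homogeneous of
  degree two.\<close>

lemma pos_def_lower_bound:
  fixes S :: "real^'n^'n"
  assumes "\<And>m. m \<noteq> 0 \<Longrightarrow> m \<bullet> (S *v m) > 0"
  obtains l where "l > 0" "\<And>m. l * (norm m)\<^sup>2 \<le> m \<bullet> (S *v m)"
proof -
  have cont: "continuous_on (sphere 0 1) (\<lambda>m::real^'n. m \<bullet> (S *v m))"
    by (intro continuous_intros linear_continuous_on linear_linear[THEN iffD1] matrix_vector_mul_linear)
  obtain z :: "real^'n" where z: "z \<in> sphere 0 1" "\<And>m. m \<in> sphere 0 1 \<Longrightarrow> z \<bullet> (S *v z) \<le> m \<bullet> (S *v m)"
    using continuous_attains_inf[OF _ _ cont] by (auto simp: compact_sphere)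
  have "z \<noteq> 0" using z by auto
  show ?thesis
  proof
    show "z \<bullet> (S *v z) > 0" using assms \<open>z \<noteq> 0\<close> by blast
    fix m :: "real^'n"
    show "z \<bullet> (S *v z) * (norm m)\<^sup>2 \<le> m \<bullet> (S *v m)"
    proof (cases "m = 0")
      case False
      define w where "w = (1 / norm m) *\<^sub>R m"
      have "m = norm m *\<^sub>R w" using False by (simp add: w_def)
      then have "m \<bullet> (S *v m) = (norm m)\<^sup>2 * (w \<bullet> (S *v w))"
        by (metis inner_scaleR_left inner_scaleR_right matrix_vector_mult_scaleR mult.assoc power2_eq_square)
      moreover have "w \<in> sphere 0 1" using False by (simp add: w_def)
      ultimately show ?thesis using z(2)[of w] by (simp add: mult.commute mult_right_mono)
    qed simp
  qed
qed

text \<open>The modulus of the summand of \<open>theta\<close> at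
  \<open>(1/2) *s cvec d + imag_vec r\<close>, for a period matrix equal to \<open>\<i>\<close>
  times \<open>S\<close>.\<close>

definition theta_term :: "real^'n^'n \<Rightarrow> real^'n \<Rightarrow> int^'n \<Rightarrow> real" where
  "theta_term S r m = exp (- pi * (rvec m \<bullet> (S *v rvec m)) - 2 * pi * (rvec m \<bullet> r))"

text \<open>The lower bound for the quadratic form and \<open>norm r \<le> R\<close> decouple the
  coordinates of \<open>m\<close>, so a product of one-dimensional Gaussians is a majorant. As
  \<open>M\<close> is the same for all \<open>r\<close> in the ball, it gives continuity as well as
  summability.\<close>

lemma theta_term_dominated:
  fixes S :: "real^'n^'n"
  assumes "\<And>m. m \<noteq> 0 \<Longrightarrow> m \<bullet> (S *v m) > 0"
  obtains M where "M summable_on UNIV" "\<And>m r. norm r \<le> R \<Longrightarrow> theta_term S r m \<le> M m"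
proof -
  obtain l where l: "l > 0" "\<And>m. l * (norm m)\<^sup>2 \<le> m \<bullet> (S *v m)"
    using pos_def_lower_bound[OF assms] by blast
  define M where "M m = (\<Prod>i\<in>UNIV. exp (- (pi * l) * (real_of_int (m $ i))\<^sup>2 + (2 * pi * R) * \<bar>real_of_int (m $ i)\<bar>))"
    for m :: "int^'n"
  show ?thesis
  proof
    show "M summable_on UNIV" unfolding M_def
      using l by (intro summable_on_prod_vec[of "\<lambda>k. exp (- (pi * l) * (real_of_int k)\<^sup>2 + (2 * pi * R) * \<bar>real_of_int k\<bar>)"]
          summable_on_gaussian_int) auto
    fix m :: "int^'n" and r :: "real^'n" assume r: "norm r \<le> R"
    have 1: "(norm (rvec m))\<^sup>2 = (\<Sum>i\<in>UNIV. (real_of_int (m $ i))\<^sup>2)"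
      unfolding power2_norm_eq_inner by (simp add: inner_vec_def rvec_def power2_eq_square)
    have "- (rvec m \<bullet> r) = (\<Sum>i\<in>UNIV. - (real_of_int (m $ i) * r $ i))"
      by (simp add: inner_vec_def rvec_def sum_negf)
    also have "\<dots> \<le> (\<Sum>i\<in>UNIV. \<bar>real_of_int (m $ i)\<bar> * R)"
    proof (rule sum_mono)
      fix i
      have "- (real_of_int (m $ i) * r $ i) \<le> \<bar>real_of_int (m $ i)\<bar> * \<bar>r $ i\<bar>"
        by (metis abs_ge_minus_self abs_mult)
      also have "\<dots> \<le> \<bar>real_of_int (m $ i)\<bar> * R"
        using r component_le_norm_cart[of r i] by (intro mult_left_mono) auto
      finally show "- (real_of_int (m $ i) * r $ i) \<le> \<bar>real_of_int (m $ i)\<bar> * R" .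
    qed
    finally have 2: "- (rvec m \<bullet> r) \<le> (\<Sum>i\<in>UNIV. \<bar>real_of_int (m $ i)\<bar> * R)" .
    have "- pi * (rvec m \<bullet> (S *v rvec m)) \<le> - pi * (l * (\<Sum>i\<in>UNIV. (real_of_int (m $ i))\<^sup>2))"
      using l(2)[of "rvec m"] by (simp add: 1)
    moreover have "- 2 * pi * (rvec m \<bullet> r) \<le> 2 * pi * (\<Sum>i\<in>UNIV. \<bar>real_of_int (m $ i)\<bar> * R)"
      using mult_left_mono[OF 2, of "2 * pi"] by simp
    ultimately have "- pi * (rvec m \<bullet> (S *v rvec m)) - 2 * pi * (rvec m \<bullet> r)
        \<le> (\<Sum>i\<in>UNIV. - (pi * l) * (real_of_int (m $ i))\<^sup>2 + (2 * pi * R) * \<bar>real_of_int (m $ i)\<bar>)"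
      by (simp add: sum.distrib sum_subtractf sum_distrib_left sum_negf mult_ac)
    then show "theta_term S r m \<le> M m"
      unfolding theta_term_def M_def exp_sum[OF finite, symmetric] by (rule exp_mono)
  qed
qed

section \<open>The real theta series: positivity, continuity and zeros\<close>

definition theta_real :: "real^'n^'n \<Rightarrow> int^'n \<Rightarrow> real^'n \<Rightarrow> real" where
  "theta_real S d r = (\<Sum>\<^sub>\<infinity>m\<in>UNIV. parity_sign (\<Sum>i\<in>UNIV. m $ i * d $ i) * theta_term S r m)"

lemma theta_summable:
  fixes S :: "real^'n^'n"
  assumes pd: "\<And>m. m \<noteq> 0 \<Longrightarrow> m \<bullet> (S *v m) > 0"
  shows "(\<lambda>m. parity_sign (\<Sum>i\<in>UNIV. m $ i * d $ i) * theta_term S r m) summable_on UNIV"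
proof -
  obtain M where M: "M summable_on UNIV" "\<And>m s. norm s \<le> norm r \<Longrightarrow> theta_term S s m \<le> M m"
    using theta_term_dominated[OF pd] by metis
  have "(\<lambda>m. norm (parity_sign (\<Sum>i\<in>UNIV. m $ i * d $ i) * theta_term S r m)) summable_on UNIV"
  proof (rule Infinite_Sum.abs_summable_on_comparison_test'[OF M(1)])
    fix m
    show "norm (parity_sign (\<Sum>i\<in>UNIV. m $ i * d $ i) * theta_term S r m) \<le> M m"
      using M(2)[of r m] by (simp add: parity_sign_def theta_term_def)
  qed
  then show ?thesis by (rule abs_summable_summable)
qed

text \<open>The real part \<open>d / 2\<close> of the argument turns into the sign of each summand;
  what remains in the exponent is real.\<close>

lemma theta_half_integer:
  fixes S :: "real^'n^'n" and d :: "int^'n"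
  assumes T: "\<And>i j. T $ i $ j = \<i> * of_real (S $ i $ j)"
    and pd: "\<And>m. m \<noteq> 0 \<Longrightarrow> m \<bullet> (S *v m) > 0"
  shows "theta ((1/2) *s cvec d + imag_vec r) T = of_real (theta_real S d r)"
proof -
  have "exp (\<i> * of_real pi * scalar_product (cvec m) (T *v cvec m)
         + 2 * \<i> * of_real pi * scalar_product (cvec m) ((1/2) *s cvec d + imag_vec r))
     = of_real (parity_sign (\<Sum>i\<in>UNIV. m $ i * d $ i)
      * exp (- pi * (rvec m \<bullet> (S *v rvec m)) - 2 * pi * (rvec m \<bullet> r)))" for m :: "int^'n"
  proof -
    have 1: "scalar_product (cvec m) (T *v cvec m) = \<i> * of_real (rvec m \<bullet> (S *v rvec m))"
      by (simp add: scalar_product_def matrix_vector_mult_def cvec_def rvec_def inner_vec_def T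
          sum_distrib_left mult_ac)
    have 2: "scalar_product (cvec m) ((1/2) *s cvec d + imag_vec r)
        = of_int (\<Sum>i\<in>UNIV. m $ i * d $ i) / 2 + \<i> * of_real (rvec m \<bullet> r)"
      by (simp add: scalar_product_def cvec_def rvec_def inner_vec_def imag_vec_def
          sum_distrib_left mult_ac distrib_left sum.distrib sum_divide_distrib)
    have "\<i> * of_real pi * scalar_product (cvec m) (T *v cvec m)
         + 2 * \<i> * of_real pi * scalar_product (cvec m) ((1/2) *s cvec d + imag_vec r)
        = of_real (- pi * (rvec m \<bullet> (S *v rvec m)) - 2 * pi * (rvec m \<bullet> r))
          + \<i> * of_real pi * of_int (\<Sum>i\<in>UNIV. m $ i * d $ i)"
      unfolding 1 2 by (simp add: algebra_simps)
    then show ?thesis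
      by (simp only: exp_add exp_pi_i_int exp_of_real of_real_mult mult.commute)
  qed
  then show ?thesis unfolding theta_def theta_real_def
    using has_sum_of_real[OF has_sum_infsum[OF theta_summable[OF pd]], THEN infsumI]
    by (simp add: theta_term_def)
qed

text \<open>All signs are \<open>+1\<close>, so the series is at least its term at
  \<open>m = 0\<close>, which is \<open>1\<close>.\<close>

lemma theta_real_pos:
  fixes S :: "real^'n^'n"
  assumes pd: "\<And>m. m \<noteq> 0 \<Longrightarrow> m \<bullet> (S *v m) > 0" and even: "\<And>i. even (d $ i)"
  shows "theta_real S d r > 0"
proof -
  have s: "theta_term S r summable_on UNIV"
    using theta_summable[OF pd, of 0 r] by (simp add: parity_sign_def)
  have "even (\<Sum>i\<in>UNIV. m $ i * d $ i)" for m :: "int^'n"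
    using even by (simp add: dvd_sum)
  then have "theta_real S d r = infsum (theta_term S r) UNIV"
    by (simp add: theta_real_def parity_sign_def)
  also have "\<dots> \<ge> sum (theta_term S r) {0}"
    using s by (intro finite_sum_le_infsum) (auto simp: theta_term_def)
  finally have "sum (theta_term S r) {0} \<le> theta_real S d r" .
  moreover have "sum (theta_term S r) {0} > 0" by (simp add: theta_term_def)
  ultimately show ?thesis by linarith
qed

text \<open>The common majorant on the ball yields uniform convergence by the Weierstrass
  test.\<close>

lemma continuous_on_theta_real:
  fixes S :: "real^'n^'n"
  assumes pd: "\<And>m. m \<noteq> 0 \<Longrightarrow> m \<bullet> (S *v m) > 0"
  shows "continuous_on (cball 0 R) (theta_real S d)"
proof -
  obtain M where M: "M summable_on UNIV" "\<And>m r. norm r \<le> R \<Longrightarrow> theta_term S r m \<le> M m"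
    using theta_term_dominated[OF pd] by metis
  have "uniform_limit (cball 0 R)
     (\<lambda>X r. \<Sum>m\<in>X. parity_sign (\<Sum>i\<in>UNIV. m $ i * d $ i) * theta_term S r m)
     (\<lambda>r. \<Sum>\<^sub>\<infinity>m\<in>UNIV. parity_sign (\<Sum>i\<in>UNIV. m $ i * d $ i) * theta_term S r m)
     (finite_subsets_at_top UNIV)"
  proof (rule Weierstrass_m_test_general)
    fix m and r :: "real^'n" assume "r \<in> cball 0 R"
    then show "norm (parity_sign (\<Sum>i\<in>UNIV. m $ i * d $ i) * theta_term S r m) \<le> M m"
      using M(2)[of r m] by (simp add: parity_sign_def theta_term_def)
  qed (rule M)
  then have "continuous_on (cball 0 R) (\<lambda>r. \<Sum>\<^sub>\<infinity>m\<in>UNIV. parity_sign (\<Sum>i\<in>UNIV. m $ i * d $ i) * theta_term S r m)"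
    by (rule uniform_limit_theorem[rotated])
       (auto intro!: always_eventually continuous_intros simp: theta_term_def)
  then show ?thesis by (simp add: theta_real_def)
qed

lemma rvec_add: "rvec (m + n) = rvec m + rvec n"
  by (simp add: rvec_def vec_eq_iff)

text \<open>Quasi-periodicity: the summation index \<open>m\<close> is replaced by
  \<open>m + n\<close>. Since \<open>S\<close> may fail to be symmetric, the two cross terms of the
  quadratic form are matched by a shift with the symmetric part of \<open>S\<close>.\<close>

lemma theta_real_shift:
  fixes S :: "real^'n^'n" and n :: "int^'n"
  shows "theta_real S d (r + (1/2) *\<^sub>R (S *v rvec n + transpose S *v rvec n))
    = exp (pi * (rvec n \<bullet> (S *v rvec n)) + 2 * pi * (rvec n \<bullet> r))
      * parity_sign (\<Sum>i\<in>UNIV. n $ i * d $ i) * theta_real S d r"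
proof -
  define c where "c = exp (pi * (rvec n \<bullet> (S *v rvec n)) + 2 * pi * (rvec n \<bullet> r))
      * parity_sign (\<Sum>i\<in>UNIV. n $ i * d $ i)"
  let ?f = "\<lambda>r m. parity_sign (\<Sum>i\<in>UNIV. m $ i * d $ i) * theta_term S r m"
  let ?r = "r + (1/2) *\<^sub>R (S *v rvec n + transpose S *v rvec n)"
  have "?f ?r m = c * ?f r (m + n)" for m
  proof -
    have p: "parity_sign (\<Sum>i\<in>UNIV. (m + n) $ i * d $ i)
        = parity_sign (\<Sum>i\<in>UNIV. m $ i * d $ i) * parity_sign (\<Sum>i\<in>UNIV. n $ i * d $ i)"
      by (simp add: distrib_right sum.distrib) (auto simp: parity_sign_def)
    have q: "parity_sign a * parity_sign a = 1" for a
      by (simp add: parity_sign_def)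
    have t: "rvec m \<bullet> (rvec n v* S) = rvec n \<bullet> (S *v rvec m)"
      by (metis dot_lmul_matrix inner_commute)
    have e: "theta_term S ?r m = exp (pi * (rvec n \<bullet> (S *v rvec n)) + 2 * pi * (rvec n \<bullet> r)) * theta_term S r (m + n)"
      unfolding theta_term_def exp_add[symmetric] rvec_add
      by (simp add: inner_simps matrix_vector_right_distrib t algebra_simps)
    have "c * ?f r (m + n) = exp (pi * (rvec n \<bullet> (S *v rvec n)) + 2 * pi * (rvec n \<bullet> r))
       * theta_term S r (m + n) * parity_sign (\<Sum>i\<in>UNIV. m $ i * d $ i)
       * (parity_sign (\<Sum>i\<in>UNIV. n $ i * d $ i) * parity_sign (\<Sum>i\<in>UNIV. n $ i * d $ i))"
      unfolding c_def p by (simp only: mult_ac)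
    also have "\<dots> = ?f ?r m"
      by (simp only: q e mult_1_right mult.commute)
    finally show ?thesis ..
  qed
  then have "theta_real S d ?r = (\<Sum>\<^sub>\<infinity>m\<in>UNIV. c * ?f r (m + n))"
    by (simp add: theta_real_def)
  also have "\<dots> = c * (\<Sum>\<^sub>\<infinity>m\<in>UNIV. ?f r (m + n))"
    by (rule infsum_cmult_right')
  also have "(\<Sum>\<^sub>\<infinity>m\<in>UNIV. ?f r (m + n)) = theta_real S d r"
    unfolding theta_real_def by (intro infsum_reindex_bij_betw bij_betwI[where g="\<lambda>m. m - n"]) auto
  finally show ?thesis by (simp add: c_def)
qed

text \<open>The shift by the \<open>j\<close>-th unit vector multiplies the value at
  \<open>0\<close> by a negative number, because \<open>d $ j\<close> is odd. The intermediate value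
  theorem on a ball containing both points does the rest.\<close>

lemma theta_real_has_zero:
  fixes S :: "real^'n^'n"
  assumes pd: "\<And>m. m \<noteq> 0 \<Longrightarrow> m \<bullet> (S *v m) > 0" and odd: "odd (d $ j)"
  shows "\<exists>r. theta_real S d r = 0"
proof -
  define n :: "int^'n" where "n = (\<chi> i. if i = j then 1 else 0)"
  define r where "r = (1/2) *\<^sub>R (S *v rvec n + transpose S *v rvec n)"
  have "(\<Sum>i\<in>UNIV. n $ i * d $ i) = d $ j"
    by (simp add: n_def if_distrib[of "\<lambda>x. x * _"] cong: if_cong)
  then have eq: "theta_real S d r = - (exp (pi * (rvec n \<bullet> (S *v rvec n))) * theta_real S d 0)"
    using theta_real_shift[of S d 0 n] odd by (simp add: r_def parity_sign_def)
  have "connected (theta_real S d ` cball 0 (norm r))"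
    by (intro connected_continuous_image continuous_on_theta_real pd) simp_all
  then have iv: "is_interval (theta_real S d ` cball 0 (norm r))"
    by (simp add: is_interval_connected_1)
  have in0: "theta_real S d 0 \<in> theta_real S d ` cball 0 (norm r)"
    and in1: "theta_real S d r \<in> theta_real S d ` cball 0 (norm r)" by auto
  have "0 \<in> theta_real S d ` cball 0 (norm r)"
  proof (cases "theta_real S d 0 \<ge> 0")
    case True
    then have "theta_real S d r \<le> 0" by (simp add: eq)
    then show ?thesis using iv in0 in1 True unfolding is_interval_1 by blast
  next
    case False
    then have "theta_real S d r \<ge> 0" by (simp add: eq mult_nonneg_nonpos)
    then show ?thesis using iv in0 in1 False unfolding is_interval_1 by (meson linear)
  qed
  then show ?thesis by auto
qed

lemma theta_half_integer_nonvanishing_iff: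
  fixes S :: "real^'n^'n" and d :: "int^'n"
  assumes T: "\<And>i j. T $ i $ j = \<i> * of_real (S $ i $ j)"
    and pd: "\<And>m. m \<noteq> 0 \<Longrightarrow> m \<bullet> (S *v m) > 0"
  shows "(\<forall>r. theta ((1/2) *s cvec d + imag_vec r) T \<noteq> 0) \<longleftrightarrow> (\<forall>i. even (d $ i))"
proof -
  have "theta ((1/2) *s cvec d + imag_vec r) T \<noteq> 0 \<longleftrightarrow> theta_real S d r \<noteq> 0" for r
    by (simp add: theta_half_integer[OF T pd])
  moreover have "(\<forall>r. theta_real S d r \<noteq> 0) \<longleftrightarrow> (\<forall>i. even (d $ i))"
    using theta_real_pos[OF pd, where d = d] theta_real_has_zero[OF pd, where d = d]
    by (metis less_irrefl)
  ultimately show ?thesis by simp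
qed

section \<open>Square-root singularities and the boundary values of the form\<close>

text \<open>The real \<open>sqrt\<close> is an odd function, so \<open>2 * sqrt (x - c)\<close> is a
  primitive on both sides of \<open>c\<close>. It is continuous at \<open>c\<close>, which is
  therefore an admissible exceptional point.\<close>

lemma integrable_inverse_sqrt_abs:
  "(\<lambda>x. 1 / sqrt \<bar>x - c\<bar>) integrable_on {a..b::real}"
proof (cases "a \<le> b")
  case True
  have "((\<lambda>x. 1 / sqrt \<bar>x - c\<bar>) has_integral (2 * sqrt (b - c) - 2 * sqrt (a - c))) {a..b}"
  proof (rule fundamental_theorem_of_calculus_strong[of "{c}"])
    fix x assume x: "x \<in> {a..b} - {c}"
    have "(sqrt has_field_derivative 1 / sqrt \<bar>x - c\<bar> / 2) (at (x - c))"
      using x real_sqrt_minus[of "x - c"]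
      by (intro DERIV_real_sqrt_generic) (auto simp: field_simps)
    then have "((\<lambda>x. sqrt (x - c)) has_field_derivative 1 / sqrt \<bar>x - c\<bar> / 2 * 1) (at x)"
      by (rule DERIV_chain2) (auto intro!: derivative_eq_intros)
    from DERIV_cmult[OF this, of 2]
    have "((\<lambda>x. 2 * sqrt (x - c)) has_field_derivative 1 / sqrt \<bar>x - c\<bar>) (at x)" by simp
    then show "((\<lambda>x. 2 * sqrt (x - c)) has_vector_derivative 1 / sqrt \<bar>x - c\<bar>) (at x)"
      by (simp add: has_real_derivative_iff_has_vector_derivative)
  qed (use True in \<open>auto intro!: continuous_intros\<close>)
  then show ?thesis by blast
qed (simp add: integrable_on_empty)

text \<open>Two factors with distinct singularities are never large together. This reduces
  integrability of the product to that of single inverse square roots.\<close>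

lemma prod_inverse_sqrt_bound:
  fixes e :: "'a \<Rightarrow> real"
  assumes "finite I" "I \<noteq> {}" "inj_on e I"
  shows "\<exists>C\<ge>0. \<forall>x. (\<Prod>i\<in>I. 1 / sqrt \<bar>x - e i\<bar>) \<le> C * (\<Sum>i\<in>I. 1 / sqrt \<bar>x - e i\<bar>)"
  using assms
proof (induction I rule: finite_ne_induct)
  case (singleton i)
  show ?case by (intro exI[of _ 1]) auto
next
  case (insert j I)
  let ?a = "\<lambda>i x. 1 / sqrt \<bar>x - e i\<bar>"
  obtain C where C: "C \<ge> 0" "\<And>x. (\<Prod>i\<in>I. ?a i x) \<le> C * (\<Sum>i\<in>I. ?a i x)"
    using insert by (auto simp: inj_on_insert)
  define D where "D i = 1 / sqrt (\<bar>e i - e j\<bar> / 2)" for i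
  have two: "?a i x * ?a j x \<le> D i * (?a i x + ?a j x)" if "i \<in> I" for i x
  proof -
    have ne: "e i \<noteq> e j" using insert that by (auto simp: inj_on_def)
    then have "\<bar>e i - e j\<bar> / 2 > 0" by simp
    \<comment> \<open>Every \<open>x\<close> is at least half the distance of \<open>e i\<close> and
      \<open>e j\<close> away from one of them, so one of the two factors is at most
      \<open>D i\<close>.\<close>
    have "\<bar>e i - e j\<bar> / 2 \<le> \<bar>x - e i\<bar> \<or> \<bar>e i - e j\<bar> / 2 \<le> \<bar>x - e j\<bar>"
      by (smt (verit) field_sum_of_halves)
    moreover have "1 / sqrt u \<le> D i" if "\<bar>e i - e j\<bar> / 2 \<le> u" for u
      unfolding D_def using that \<open>\<bar>e i - e j\<bar> / 2 > 0\<close> by (intro frac_le) auto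
    ultimately have "?a i x \<le> D i \<or> ?a j x \<le> D i" by blast
    moreover have "?a i x \<ge> 0" "?a j x \<ge> 0" "D i \<ge> 0" by (auto simp: D_def)
    ultimately show ?thesis
      by (smt (verit, best) mult_left_mono mult_right_mono mult.commute distrib_left mult_nonneg_nonneg)
  qed
  define C' where "C' = C * (\<Sum>i\<in>I. D i)"
  have Dn: "D i \<ge> 0" for i by (simp add: D_def)
  show ?case
  proof (intro exI[of _ "C'"] conjI allI)
    show "C' \<ge> 0" using C Dn by (auto simp: C'_def intro!: mult_nonneg_nonneg sum_nonneg)
    fix x
    let ?S = "\<Sum>i\<in>insert j I. ?a i x"
    have "(\<Prod>i\<in>insert j I. ?a i x) = (\<Prod>i\<in>I. ?a i x) * ?a j x"
      using insert by (simp add: mult.commute)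
    also have "\<dots> \<le> C * (\<Sum>i\<in>I. ?a i x) * ?a j x"
      by (intro mult_right_mono C) auto
    also have "\<dots> = C * (\<Sum>i\<in>I. ?a i x * ?a j x)"
      by (simp only: sum_distrib_right mult.assoc)
    also have "\<dots> \<le> C * (\<Sum>i\<in>I. D i * ?S)"
    proof (intro mult_left_mono sum_mono C)
      fix i assume i: "i \<in> I"
      have "i \<noteq> j" using i insert.hyps by auto
      then have "?a i x + ?a j x = (\<Sum>k\<in>{i, j}. ?a k x)" by simp
      also have "\<dots> \<le> ?S"
        using i insert by (intro sum_mono2) auto
      finally have "D i * (?a i x + ?a j x) \<le> D i * ?S"
        using Dn by (rule mult_left_mono)
      with two[OF i, of x] show "?a i x * ?a j x \<le> D i * ?S" by linarith
    qed
    also have "\<dots> = C' * ?S" by (simp add: C'_def sum_distrib_right mult.assoc)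
    finally show "(\<Prod>i\<in>insert j I. ?a i x) \<le> C' * ?S" .
  qed
qed

section \<open>The square root on the upper half-plane and its boundary values\<close>

locale branch_points =
  fixes g :: nat and e :: "nat \<Rightarrow> real"
  assumes strict_mono: "strict_mono_on {1..2*g+1} e"
begin

lemma e_less: "1 \<le> i \<Longrightarrow> i < j \<Longrightarrow> j \<le> 2*g+1 \<Longrightarrow> e i < e j"
  using strict_mono by (auto simp: strict_mono_on_def)

lemma e_le: "1 \<le> i \<Longrightarrow> i \<le> j \<Longrightarrow> j \<le> 2*g+1 \<Longrightarrow> e i \<le> e j"
  using e_less[of i j] by (cases "i = j") auto

definition J :: "nat set" where "J = {1..2*g+1}"

lemma J_facts: "finite J" "J \<noteq> {}" "inj_on e J"
  using strict_mono by (auto simp: J_def intro: strict_mono_on_imp_inj_on)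

text \<open>The junk value at a branch point is \<open>0\<close>, on both sides of lemma \<open>inverse_root_fun_real\<close>.\<close>

definition weight :: "real \<Rightarrow> real" where
  "weight x = (\<Prod>i\<in>J. 1 / sqrt \<bar>x - e i\<bar>)"

definition roots_above :: "real \<Rightarrow> nat" where
  "roots_above x = card {i \<in> J. x < e i}"

text \<open>Principal roots are taken factor by factor, not of the product: every factor
  \<open>z - e i\<close> stays in the upper half-plane with \<open>z\<close>, away from the branch
  cut of \<open>csqrt\<close>.\<close>

definition root_fun :: "complex \<Rightarrow> complex" where
  "root_fun z = (\<Prod>i\<in>J. csqrt (z - of_real (e i)))"

abbreviation E :: "real set" where "E \<equiv> e ` J"

lemma weight_nonneg: "weight x \<ge> 0"
  by (simp add: weight_def prod_nonneg)

lemma weight_pos: "x \<notin> E \<Longrightarrow> weight x > 0"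
  unfolding weight_def by (intro prod_pos) auto

text \<open>\<open>f\<close> is bounded on the interval, and \<open>weight\<close> is at most a
  multiple of a sum of single inverse square roots.\<close>

lemma integrable_weight:
  assumes f: "continuous_on UNIV f"
  shows "(\<lambda>x. f x * weight x) integrable_on {a..b}"
proof -
  obtain C where C: "C \<ge> 0" "\<And>x. weight x \<le> C * (\<Sum>i\<in>J. 1 / sqrt \<bar>x - e i\<bar>)"
    using prod_inverse_sqrt_bound[OF J_facts] unfolding weight_def by auto
  have "bounded (f ` {a..b})"
    using f by (intro compact_imp_bounded compact_continuous_image) (auto intro: continuous_on_subset)
  then obtain B where "\<forall>y\<in>f ` {a..b}. norm y \<le> B"
    unfolding bounded_iff by blast
  then have B: "\<bar>f x\<bar> \<le> B" if "x \<in> {a..b}" for x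
    using that by simp
  show ?thesis
  proof (rule measurable_bounded_by_integrable_imp_integrable)
    have "(\<lambda>x. f x * weight x) \<in> borel_measurable borel"
      unfolding weight_def using borel_measurable_continuous_onI[OF f] by measurable
    then show "(\<lambda>x. f x * weight x) \<in> borel_measurable (lebesgue_on {a..b})"
      by (intro measurable_restrict_space1 measurable_completion) simp
    show "(\<lambda>x. B * (C * (\<Sum>i\<in>J. 1 / sqrt \<bar>x - e i\<bar>))) integrable_on {a..b}"
      by (intro integrable_on_mult_right integrable_sum integrable_inverse_sqrt_abs J_facts)
    fix x assume x: "x \<in> {a..b}"
    show "norm (f x * weight x) \<le> B * (C * (\<Sum>i\<in>J. 1 / sqrt \<bar>x - e i\<bar>))"
      unfolding real_norm_def abs_mult
      using B[OF x] C(2)[of x] weight_nonneg[of x] by (intro mult_mono) auto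
  qed (auto simp: J_facts)
qed

lemma root_fun_squared: "(root_fun z)\<^sup>2 = (\<Prod>i\<in>J. z - of_real (e i))"
  unfolding root_fun_def prod_power_distrib by simp

lemma norm_root_fun: "norm (root_fun z) = (\<Prod>i\<in>J. sqrt (norm (z - of_real (e i))))"
  by (simp add: root_fun_def prod_norm [symmetric])

lemma root_fun_nonzero: "Im z > 0 \<Longrightarrow> root_fun z \<noteq> 0"
  by (auto simp: root_fun_def J_facts dest!: arg_cong[where f = Im])

lemma holomorphic_root_fun: "root_fun holomorphic_on {z. Im z > 0}"
  unfolding root_fun_def
  by (intro holomorphic_intros) (auto simp: complex_nonpos_Reals_iff)

text \<open>On the negative axis \<open>csqrt\<close> is discontinuous, but its value there is the
  limit from above: in the upper half-plane \<open>csqrt z = \<i> * csqrt (- z)\<close>, and the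
  right-hand side is continuous there.\<close>

lemma csqrt_tendsto_upper:
  assumes "x \<noteq> 0"
  shows "(csqrt \<longlongrightarrow> csqrt (of_real x)) (at (of_real x) within {z. Im z > 0})"
proof (cases "x > 0")
  case True
  then have "isCont csqrt (of_real x)"
    by (intro continuous_at_csqrt) (auto simp: complex_nonpos_Reals_iff)
  then show ?thesis
    by (metis continuous_at_imp_continuous_within continuous_within)
next
  case False
  with assms have x: "x < 0" by simp
  have "isCont csqrt (- of_real x)"
    using x by (intro continuous_at_csqrt) (auto simp: complex_nonpos_Reals_iff)
  then have "isCont (\<lambda>z. csqrt (- z)) (of_real x)"
    by (rule isCont_o2[where f = uminus, rotated]) (rule continuous_minus[OF continuous_ident])
  then have "isCont (\<lambda>z. \<i> * csqrt (- z)) (of_real x)"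
    by (rule continuous_mult[OF continuous_const])
  then have lim: "((\<lambda>z. \<i> * csqrt (- z)) \<longlongrightarrow> \<i> * csqrt (- of_real x)) (at (of_real x) within {z. Im z > 0})"
    by (metis continuous_at_imp_continuous_within continuous_within)
  have eq: "\<i> * csqrt (- z) = csqrt z" if "Im z > 0" for z
    using csqrt_minus[of "- z"] that by simp
  have ev: "\<forall>\<^sub>F z in at (complex_of_real x) within {z. Im z > 0}. \<i> * csqrt (- z) = csqrt z"
    unfolding eventually_at_filter by (intro always_eventually) (simp add: eq)
  have "\<i> * csqrt (- of_real x) = csqrt (of_real x)"
    using x csqrt_of_real'[of x] csqrt_of_real'[of "- x"] by simp
  then show ?thesis
    using tendsto_cong[THEN iffD1, OF ev lim] by simp
qed

text \<open>Boundary values from above can thus be read off by evaluating \<open>root_fun\<close> on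
  the real axis.\<close>

lemma root_fun_tendsto:
  assumes "x \<notin> E"
  shows "(root_fun \<longlongrightarrow> root_fun (of_real x)) (at (of_real x) within {z. Im z > 0})"
  unfolding root_fun_def
proof (rule tendsto_prod)
  fix i assume "i \<in> J"
  with assms have ne: "x - e i \<noteq> 0" by auto
  have "((\<lambda>z. z - of_real (e i)) \<longlongrightarrow> of_real (x - e i)) (at (of_real x) within {z. Im z > 0})"
    by (auto intro!: tendsto_eq_intros)
  then have lim: "filterlim (\<lambda>z. z - of_real (e i)) (at (of_real (x - e i)) within {z. Im z > 0})
      (at (of_real x) within {z. Im z > 0})"
    unfolding filterlim_at by (auto simp: eventually_at_filter)
  show "((\<lambda>z. csqrt (z - of_real (e i))) \<longlongrightarrow> csqrt (of_real x - of_real (e i)))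
      (at (of_real x) within {z. Im z > 0})"
    using filterlim_compose[OF csqrt_tendsto_upper[OF ne] lim] by simp
qed

text \<open>Each branch point to the right of \<open>x\<close> has a root that is
  \<open>\<i>\<close> times a positive number, hence contributes \<open>- \<i>\<close> to the
  inverse. The phase is therefore constant between consecutive branch points.\<close>

lemma inverse_root_fun_real:
  "1 / root_fun (of_real x) = (- \<i>) ^ roots_above x * of_real (weight x)"
proof -
  have "1 / csqrt (of_real x - of_real (e i)) = (if x < e i then - \<i> else 1) * of_real (1 / sqrt \<bar>x - e i\<bar>)" for i
    using csqrt_of_real'[of "x - e i"] by (auto simp: field_simps)
  moreover have "1 / root_fun (of_real x) = (\<Prod>i\<in>J. 1 / csqrt (of_real x - of_real (e i)))"
    by (simp add: root_fun_def prod_dividef)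
  ultimately have "1 / root_fun (of_real x)
      = (\<Prod>i\<in>J. (if x < e i then - \<i> else 1) * of_real (1 / sqrt \<bar>x - e i\<bar>))"
    by simp
  also have "\<dots> = (\<Prod>i\<in>J. if x < e i then - \<i> else 1) * of_real (weight x)"
    by (simp only: prod.distrib weight_def of_real_prod)
  also have "(\<Prod>i\<in>J. if x < e i then - \<i> else 1) = (- \<i>) ^ roots_above x"
    by (simp add: prod.If_cases J_facts roots_above_def Int_def)
  finally show ?thesis .
qed

end

section \<open>Decay at infinity and Cauchy's theorem along the real axis\<close>

lemma poly_of_real: "poly (map_poly of_real p) (of_real x) = (of_real (poly p x) :: complex)"
  by (induction p) (simp_all add: map_poly_pCons)

lemma norm_poly_le:
  fixes p :: "complex poly"
  assumes "degree p \<le> n" "norm z \<ge> 1"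
  shows "norm (poly p z) \<le> (\<Sum>i\<le>degree p. norm (coeff p i)) * norm z ^ n"
proof -
  have "norm (poly p z) \<le> (\<Sum>i\<le>degree p. norm (coeff p i * z ^ i))"
    unfolding poly_altdef by (rule norm_sum)
  also have "\<dots> \<le> (\<Sum>i\<le>degree p. norm (coeff p i) * norm z ^ n)"
    using assms by (intro sum_mono) (auto simp: norm_mult norm_power intro!: mult_left_mono power_increasing)
  finally show ?thesis by (simp add: sum_distrib_right)
qed

text \<open>This vertical sequence makes boundary limits accessible to dominated convergence, and it
  witnesses that the filter is nontrivial.\<close>

lemma filterlim_upper:
  "filterlim (\<lambda>k. Complex x (1 / real (Suc k))) (at (of_real x) within {z. Im z > 0}) sequentially"
proof -
  have "(\<lambda>k. Complex x (1 / real (Suc k))) \<longlonglongrightarrow> Complex x 0"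
    by (intro tendsto_Complex tendsto_const LIMSEQ_Suc lim_1_over_n)
  then show ?thesis
    unfolding filterlim_at by (auto simp: complex_of_real_def)
qed

context branch_points
begin

text \<open>The boundary values of \<open>form p\<close> on the real axis, with phase and weight of
  the inverse square root separated.\<close>

definition bdry_form :: "real poly \<Rightarrow> real \<Rightarrow> complex" where
  "bdry_form p x = of_real (poly p x) * ((- \<i>) ^ roots_above x * of_real (weight x))"

definition form :: "real poly \<Rightarrow> complex \<Rightarrow> complex" where
  "form p z = poly (map_poly of_real p) z / root_fun z"

lemma form_real: "form p (of_real x) = bdry_form p x"
  by (simp add: form_def bdry_form_def poly_of_real divide_inverse inverse_root_fun_real [symmetric])

text \<open>The numerator grows at most like the power \<open>g - 1\<close> of
  \<open>norm z\<close>, the root like the power \<open>g + 1/2\<close>, which leaves the power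
  \<open>-3/2\<close>.\<close>

lemma form_decay:
  assumes "degree p < g"
  obtains A r where "A \<ge> 0" "r \<ge> 1" "\<And>z. norm z \<ge> r \<Longrightarrow> norm (form p z) \<le> A / (norm z * sqrt (norm z))"
proof -
  define P where "P = (map_poly of_real p :: complex poly)"
  define c where "c = (\<Sum>i\<le>degree P. norm (coeff P i))"
  define m where "m = Max ((\<lambda>i. \<bar>e i\<bar>) ` J)"
  \<comment> \<open>Beyond \<open>2 * m\<close> every factor satisfies
    \<open>norm (z - e i) \<ge> norm z / 2\<close>.\<close>
  define r where "r = max 1 (2 * m)"
  have m: "\<bar>e i\<bar> \<le> m" if "i \<in> J" for i
    unfolding m_def using that J_facts by (intro Max_ge) auto
  have c: "c \<ge> 0" by (simp add: c_def sum_nonneg)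
  have dP: "degree P \<le> g - 1" using assms
    by (auto simp: P_def coeff_map_poly coeff_eq_0 intro!: degree_le)
  show ?thesis
  proof
    show "c * (2 ^ g * sqrt 2) \<ge> 0" using c by simp
    show "r \<ge> 1" by (simp add: r_def)
    fix z :: complex assume z: "norm z \<ge> r"
    then have z1: "norm z \<ge> 1" and z2: "norm z \<ge> 2 * m" by (auto simp: r_def)
    have "sqrt (norm z / 2) ^ (2 * g + 1) = (\<Prod>i\<in>J. sqrt (norm z / 2))"
      by (simp add: J_def)
    also have "\<dots> \<le> norm (root_fun z)"
      unfolding norm_root_fun
    proof (intro prod_mono conjI)
      fix i assume i: "i \<in> J"
      have "norm z - norm (of_real (e i) :: complex) \<le> norm (z - of_real (e i))"
        by (rule norm_triangle_ineq2)
      then have "norm z / 2 \<le> norm (z - of_real (e i))"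
        using m[OF i] z2 by simp
      then show "sqrt (norm z / 2) \<le> sqrt (norm (z - of_real (e i)))" by simp
    qed (use z1 in auto)
    finally have R: "sqrt (norm z / 2) ^ (2 * g + 1) \<le> norm (root_fun z)" .
    have pos: "sqrt (norm z / 2) ^ (2 * g + 1) > 0"
      using z1 by (intro zero_less_power) auto
    have "norm (form p z) \<le> (c * norm z ^ (g - 1)) / sqrt (norm z / 2) ^ (2 * g + 1)"
      unfolding form_def norm_divide P_def[symmetric] c_def
      using R z1 c pos by (intro frac_le norm_poly_le dP) (auto simp: c_def simp del: power_Suc)
    also have "sqrt (norm z / 2) ^ (2 * g + 1) = (norm z / 2) ^ g * sqrt (norm z / 2)"
      using z1 by (simp add: power_mult)
    also have "(c * norm z ^ (g - 1)) / ((norm z / 2) ^ g * sqrt (norm z / 2))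
        = c * (2 ^ g * sqrt 2) / (norm z * sqrt (norm z))"
    proof -
      have "norm z ^ g = norm z * norm z ^ (g - 1)" using assms by (cases g) auto
      moreover have "norm z \<noteq> 0" using z1 by auto
      ultimately show ?thesis by (simp add: power_divide real_sqrt_divide)
    qed
    finally show "norm (form p z) \<le> c * (2 ^ g * sqrt 2) / (norm z * sqrt (norm z))" .
  qed
qed

text \<open>The upper half-plane is convex and \<open>root_fun\<close> has no zero in it. The
  primitive serves as Cauchy's theorem for the rectangles that follow.\<close>

lemma form_primitive:
  obtains F where "\<And>z. Im z > 0 \<Longrightarrow> (F has_field_derivative form p z) (at z)"
proof -
  have hol: "form p holomorphic_on {z. Im z > 0}"
    unfolding form_def using root_fun_nonzero
    by (intro holomorphic_intros holomorphic_root_fun) auto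
  have op: "open {z. Im z > 0}" by (rule open_halfspace_Im_gt)
  obtain F where F: "\<And>z. z \<in> {z. Im z > 0} \<Longrightarrow> (F has_field_derivative form p z) (at z within {z. Im z > 0})"
    using holomorphic_convex_primitive'[OF convex_halfspace_Im_gt op hol] by metis
  show ?thesis
  proof (rule that)
    fix z :: complex assume "Im z > 0"
    then show "(F has_field_derivative form p z) (at z)"
      using F[of z] at_within_open[OF _ op, of z] by simp
  qed
qed

text \<open>The segment at height \<open>d\<close> is closed up to a rectangle with top at height
  \<open>T\<close>. The other three sides have total length at most \<open>4 * T\<close>, and the
  form is there at most \<open>A / (T * sqrt T)\<close>. The bound is uniform in \<open>d\<close>,
  so \<open>d\<close> may tend to \<open>0\<close>.\<close>

lemma form_line_integral_bound:
  assumes "degree p < g"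
  obtains A r where "A \<ge> 0" "r \<ge> 1"
    "\<And>T d. r \<le> T \<Longrightarrow> 0 < d \<Longrightarrow> d \<le> T \<Longrightarrow>
       (\<lambda>x. form p (Complex x d)) integrable_on {-T..T} \<and>
       norm (integral {-T..T} (\<lambda>x. form p (Complex x d))) \<le> A / sqrt T"
proof -
  obtain A r where A: "A \<ge> 0" "r \<ge> 1"
    and bound: "\<And>z. norm z \<ge> r \<Longrightarrow> norm (form p z) \<le> A / (norm z * sqrt (norm z))"
    using form_decay[OF assms] by blast
  obtain F where F: "\<And>z. Im z > 0 \<Longrightarrow> (F has_field_derivative form p z) (at z)"
    using form_primitive[of p] by metis
  show ?thesis
  proof
    show "4 * A \<ge> 0" "r \<ge> 1" using A by auto
    fix T d assume T: "r \<le> T" "0 < d" "d \<le> T"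
    then have T1: "T \<ge> 1" using A by simp
    define B where "B = A / (T * sqrt T)"
    have B: "norm (form p z) \<le> B" if "norm z \<ge> T" for z
    proof -
      have "norm (form p z) \<le> A / (norm z * sqrt (norm z))" using bound that T by simp
      also have "\<dots> \<le> B" unfolding B_def
        using A T1 that by (intro divide_left_mono mult_mono mult_pos_pos) auto
      finally show ?thesis .
    qed
    \<comment> \<open>The mean value inequality for \<open>F\<close>; each of the three sides is
      placed in a convex region on which \<open>norm z \<ge> T\<close>.\<close>
    have seg: "norm (F z - F w) \<le> B * norm (z - w)"
      if "convex S" "\<And>z. z \<in> S \<Longrightarrow> Im z > 0 \<and> norm z \<ge> T" "z \<in> S" "w \<in> S" for S z w
      using that B F by (intro field_differentiable_bound[of S]) (auto intro: has_field_derivative_at_within)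
    have "norm (F (Complex T d) - F (Complex T T)) \<le> B * norm (Complex T d - Complex T T)"
    proof (rule seg)
      show "convex ({z. Re z \<ge> T} \<inter> {z. Im z > 0})"
        by (intro convex_Int convex_halfspace_Im_gt convex_halfspace_Re_ge)
    qed (use T T1 complex_Re_le_cmod in \<open>auto intro: order_trans\<close>)
    moreover have "norm (F (Complex T T) - F (Complex (-T) T)) \<le> B * norm (Complex T T - Complex (-T) T)"
    proof (rule seg)
      show "convex {z. Im z \<ge> T}" by (rule convex_halfspace_Im_ge)
      show "Im z > 0 \<and> norm z \<ge> T" if "z \<in> {z. Im z \<ge> T}" for z
        using that T1 abs_Im_le_cmod[of z] by auto
    qed auto
    moreover have "norm (F (Complex (-T) T) - F (Complex (-T) d)) \<le> B * norm (Complex (-T) T - Complex (-T) d)"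
    proof (rule seg)
      show "convex ({z. Re z \<le> - T} \<inter> {z. Im z > 0})"
        by (intro convex_Int convex_halfspace_Im_gt convex_halfspace_Re_le)
      show "Im z > 0 \<and> norm z \<ge> T" if "z \<in> {z. Re z \<le> - T} \<inter> {z. Im z > 0}" for z
        using that T1 abs_Re_le_cmod[of z] by auto
    qed (use T T1 in auto)
    ultimately have "norm (F (Complex T d) - F (Complex (-T) d))
        \<le> B * norm (Complex T d - Complex T T) + B * norm (Complex T T - Complex (-T) T)
          + B * norm (Complex (-T) T - Complex (-T) d)"
      using norm_triangle_ineq[of "F (Complex T d) - F (Complex T T)" "F (Complex T T) - F (Complex (-T) T)"]
        norm_triangle_ineq[of "F (Complex T d) - F (Complex (-T) T)" "F (Complex (-T) T) - F (Complex (-T) d)"]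
      by simp
    also have "norm (Complex T d - Complex T T) = T - d" using T by (simp add: cmod_def)
    also have "norm (Complex T T - Complex (-T) T) = 2 * T" using T1 by (simp add: cmod_def real_sqrt_mult)
    also have "norm (Complex (-T) T - Complex (-T) d) = T - d" using T by (simp add: cmod_def)
    also have "B * (T - d) + B * (2 * T) + B * (T - d) = B * (4 * T - 2 * d)" by (simp add: algebra_simps)
    also have "\<dots> \<le> B * (4 * T)" using T A T1 by (intro mult_left_mono) (auto simp: B_def)
    also have "\<dots> = 4 * A / sqrt T" using T1 by (simp add: B_def)
    finally have le: "norm (F (Complex T d) - F (Complex (-T) d)) \<le> 4 * A / sqrt T" .
    have "((\<lambda>x. form p (Complex x d)) has_integral (F (Complex T d) - F (Complex (-T) d))) {-T..T}"
    proof (rule fundamental_theorem_of_calculus)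
      fix x assume "x \<in> {-T..T}"
      have "((\<lambda>x. Complex x d) has_vector_derivative 1) (at x within {-T..T})"
        unfolding Complex_eq by (auto intro!: derivative_eq_intros)
      moreover have "(F has_field_derivative form p (Complex x d)) (at (Complex x d))"
        using F T by simp
      ultimately have "(F \<circ> (\<lambda>x. Complex x d) has_vector_derivative 1 * form p (Complex x d)) (at x within {-T..T})"
        by (intro field_vector_diff_chain_within) (auto intro: has_field_derivative_at_within)
      then show "((\<lambda>x. F (Complex x d)) has_vector_derivative form p (Complex x d)) (at x within {-T..T})"
        by (simp add: o_def)
    qed (use T1 in auto)
    then show "(\<lambda>x. form p (Complex x d)) integrable_on {-T..T} \<and>
       norm (integral {-T..T} (\<lambda>x. form p (Complex x d))) \<le> 4 * A / sqrt T"
      using le by (simp add: integral_unique has_integral_integrable)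
  qed
qed

lemma form_tendsto:
  assumes "x \<notin> E"
  shows "(form p \<longlongrightarrow> bdry_form p x) (at (of_real x) within {z. Im z > 0})"
proof -
  have "root_fun (of_real x) \<noteq> 0" using assms J_facts by (auto simp: root_fun_def)
  then show ?thesis
    unfolding form_real[symmetric] form_def
    by (intro tendsto_intros root_fun_tendsto assms tendsto_poly) auto
qed

text \<open>Moving up from the real axis only increases the distance to each branch point. This
  gives a majorant for the limit \<open>d\<close> to \<open>0\<close>.\<close>

lemma norm_form_le:
  assumes "x \<notin> E" "d > 0"
  shows "norm (form p (Complex x d)) \<le> norm (poly (map_poly of_real p) (Complex x d)) * weight x"
proof -
  have "(\<Prod>i\<in>J. sqrt \<bar>x - e i\<bar>) \<le> norm (root_fun (Complex x d))"
    unfolding norm_root_fun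
  proof (intro prod_mono conjI)
    fix i
    have "\<bar>x - e i\<bar> \<le> norm (Complex x d - of_real (e i))"
      using abs_Re_le_cmod[of "Complex x d - of_real (e i)"] by simp
    then show "sqrt \<bar>x - e i\<bar> \<le> sqrt (norm (Complex x d - of_real (e i)))" by simp
  qed auto
  moreover have "(\<Prod>i\<in>J. sqrt \<bar>x - e i\<bar>) > 0" using assms by (intro prod_pos) auto
  ultimately have "inverse (norm (root_fun (Complex x d))) \<le> inverse (\<Prod>i\<in>J. sqrt \<bar>x - e i\<bar>)"
    by (rule le_imp_inverse_le)
  moreover have "inverse (\<Prod>i\<in>J. sqrt \<bar>x - e i\<bar>) = weight x"
    by (simp add: weight_def prod_dividef inverse_eq_divide)
  ultimately show ?thesis
    by (simp add: form_def norm_mult norm_inverse divide_inverse mult_left_mono)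
qed

text \<open>Dominated convergence lets the height of the segment tend to \<open>0\<close>. As
  \<open>T\<close> grows, this says that the integral along the whole real axis vanishes.\<close>

lemma bdry_form_integral_bound:
  assumes "degree p < g"
  obtains A r where "\<And>T. r \<le> T \<Longrightarrow> norm (integral {-T..T} (bdry_form p)) \<le> A / sqrt T"
proof -
  obtain A r where A: "A \<ge> 0" "r \<ge> 1" and bd:
    "\<And>T d. r \<le> T \<Longrightarrow> 0 < d \<Longrightarrow> d \<le> T \<Longrightarrow>
       (\<lambda>x. form p (Complex x d)) integrable_on {-T..T} \<and>
       norm (integral {-T..T} (\<lambda>x. form p (Complex x d))) \<le> A / sqrt T"
    using form_line_integral_bound[OF assms] by metis
  have "norm (integral {-T..T} (bdry_form p)) \<le> A / sqrt T" if T: "r \<le> T" for T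
  proof -
    \<comment> \<open>The pointwise limit is known only off the branch points, which form a null
      set.\<close>
    define S where "S = {-T..T} - E"
    define f where "f k x = form p (Complex x (1 / real (Suc k)))" for k x
    have neg: "negligible E" using J_facts by (intro negligible_finite) (simp add: J_def)
    have d: "1 / real (Suc k) \<le> T" for k
      using A T by (intro order_trans[of "1 / real (Suc k)" 1 T]) auto
    have int: "f k integrable_on S" "integral S (f k) = integral {-T..T} (f k)" for k
    proof -
      have "f k integrable_on {-T..T}"
        unfolding f_def using bd[OF T _ d[of k]] by (simp del: of_nat_Suc)
      then show "f k integrable_on S"
        by (rule integrable_spike_set) (auto intro!: negligible_subset[OF neg] simp: S_def)
      show "integral S (f k) = integral {-T..T} (f k)"
        by (rule integral_spike_set) (auto intro!: negligible_subset[OF neg] simp: S_def)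
    qed
    have nb: "norm (integral {-T..T} (f k)) \<le> A / sqrt T" for k
      unfolding f_def using bd[OF T _ d[of k]] by (simp del: of_nat_Suc)
    have "compact (cbox (Complex (-T) 0) (Complex T 1))" by (rule compact_cbox)
    then have "bounded (poly (map_poly of_real p) ` cbox (Complex (-T) 0) (Complex T 1) :: complex set)"
      by (intro compact_imp_bounded compact_continuous_image continuous_intros)
    \<comment> \<open>\<open>M\<close> bounds the numerator up to height \<open>1\<close>, which
      covers all heights \<open>1 / real (Suc k)\<close>.\<close>
    then obtain M where M: "\<And>z. z \<in> cbox (Complex (-T) 0) (Complex T 1) \<Longrightarrow>
        norm (poly (map_poly of_real p) z :: complex) \<le> M"
      unfolding bounded_iff by blast
    have "(\<lambda>k. integral S (f k)) \<longlonglongrightarrow> integral S (bdry_form p)"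
    proof (rule dominated_convergence(2))
      have "(\<lambda>x. M * weight x) integrable_on {-T..T}"
        by (rule integrable_weight) auto
      then show "(\<lambda>x. M * weight x) integrable_on S"
        by (rule integrable_spike_set) (auto intro!: negligible_subset[OF neg] simp: S_def)
      fix x assume x: "x \<in> S"
      show "norm (f k x) \<le> M * weight x" for k
      proof -
        have "norm (f k x) \<le> norm (poly (map_poly of_real p) (Complex x (1 / real (Suc k)))) * weight x"
          unfolding f_def using x by (intro norm_form_le) (auto simp: S_def)
        also have "\<dots> \<le> M * weight x"
          using x weight_nonneg by (intro mult_right_mono M) (auto simp: S_def in_cbox_complex_iff field_simps)
        finally show ?thesis .
      qed
      show "(\<lambda>k. f k x) \<longlonglongrightarrow> bdry_form p x"
        unfolding f_def using x by (intro filterlim_compose[OF form_tendsto filterlim_upper]) (auto simp: S_def)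
    qed (rule int)
    moreover have "integral S (bdry_form p) = integral {-T..T} (bdry_form p)"
      by (rule integral_spike_set) (auto intro!: negligible_subset[OF neg] simp: S_def)
    ultimately have "(\<lambda>k. integral {-T..T} (f k)) \<longlonglongrightarrow> integral {-T..T} (bdry_form p)"
      by (simp add: int)
    then show ?thesis
      using nb by (intro Lim_norm_ubound[of sequentially]) auto
  qed
  then show ?thesis by (rule that)
qed

end

section \<open>Signs of integrals and of polynomials with prescribed roots\<close>

text \<open>The middle third stays away from the ends, where the integrand may be singular; there it
  has a positive minimum.\<close>

lemma integral_pos_interior:
  fixes f :: "real \<Rightarrow> real"
  assumes "a < b" and int: "f integrable_on {a..b}" and cont: "continuous_on {a<..<b} f"
    and pos: "\<And>x. a < x \<Longrightarrow> x < b \<Longrightarrow> f x > 0"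
  shows "integral {a..b} f > 0"
proof -
  define c d where "c = (2 * a + b) / 3" and "d = (a + 2 * b) / 3"
  have cd: "a < c" "c < d" "d < b" using \<open>a < b\<close> by (auto simp: c_def d_def field_simps)
  have int': "f integrable_on {a<..<b}"
    using int by (simp add: integrable_on_Icc_iff_Ioo)
  have "continuous_on {c..d} f"
    using cont cd by (auto intro: continuous_on_subset)
  then obtain z where z: "z \<in> {c..d}" "\<And>x. x \<in> {c..d} \<Longrightarrow> f z \<le> f x"
    using continuous_attains_inf[of "{c..d}" f] cd by auto
  have icd: "f integrable_on {c..d}"
    using cd by (intro integrable_on_subinterval[OF int]) auto
  have "0 < f z * (d - c)" using pos[of z] z cd by simp
  also have "f z * (d - c) = integral {c..d} (\<lambda>x. f z)" using cd by simp
  also have "\<dots> \<le> integral {c..d} f"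
    using z icd by (intro integral_le) auto
  also have "\<dots> \<le> integral {a<..<b} f"
    using cd icd int' pos by (intro integral_subset_le) (auto intro: less_imp_le)
  also have "\<dots> = integral {a..b} f"
    by (simp add: integral_open_interval_real)
  finally show ?thesis .
qed

text \<open>Among the intervals between consecutive branch points, those with odd left index are
  cuts and those with even left index are gaps.\<close>

lemma sum_odd_even:
  "(\<Sum>j\<in>{1..<2*n+1}. f j) = (\<Sum>k=1..n. f (2*k-1)) + (\<Sum>k=1..n. f (2*k :: nat) :: 'a :: comm_monoid_add)"
proof (induction n)
  case (Suc n)
  have "{1..<2 * Suc n + 1} = insert (2*n+2) (insert (2*n+1) {1..<2*n+1})" by auto
  then show ?case using Suc by (simp add: add_ac)
qed simp

text \<open>The difference of both sides has lost its coefficient at \<open>card K\<close>, so its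
  degree is less than \<open>card K\<close>, yet it vanishes at \<open>card K\<close>
  points.\<close>

lemma poly_eq_prod_roots:
  fixes p :: "'a :: idom poly"
  assumes "finite K" "inj_on z K" "\<And>i. i \<in> K \<Longrightarrow> poly p (z i) = 0" "degree p \<le> card K"
  shows "p = smult (coeff p (card K)) (\<Prod>i\<in>K. [:- z i, 1:])"
proof (rule ccontr)
  define d where "d = (\<Prod>i\<in>K. [:- z i, 1:])"
  define q where "q = p - smult (coeff p (card K)) d"
  assume "p \<noteq> smult (coeff p (card K)) (\<Prod>i\<in>K. [:- z i, 1:])"
  then have q: "q \<noteq> 0" by (simp add: q_def d_def)
  have deg: "degree d = card K" unfolding d_def
    using assms(1) by (subst degree_prod_eq_sum_degree) auto
  have "lead_coeff d = 1" unfolding d_def by (simp add: lead_coeff_prod)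
  then have cq: "coeff q (card K) = 0" using deg by (simp add: q_def)
  have "degree q \<le> card K"
    using assms(4) deg by (auto simp: q_def intro!: degree_diff_le order_trans[OF degree_smult_le])
  with cq q have "degree q < card K"
    by (metis le_neq_implies_less leading_coeff_0_iff)
  moreover have "z ` K \<subseteq> {x. poly q x = 0}"
    using assms by (auto simp: q_def d_def poly_prod prod_zero_iff)
  then have "card K \<le> card {x. poly q x = 0}"
    using card_mono[OF poly_roots_finite[OF q]] assms by (metis card_image)
  moreover have "card {x. poly q x = 0} \<le> degree q"
    using q by (rule card_poly_roots_bound)
  ultimately show False by simp
qed

lemma sign_prod_roots:
  fixes z :: "nat \<Rightarrow> real"
  assumes "finite K" "\<And>j. j \<in> K \<Longrightarrow> x \<noteq> z j" "\<And>j. j \<in> K \<Longrightarrow> x < z j \<longleftrightarrow> i < j"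
  shows "(-1) ^ card {j \<in> K. i < j} * (\<Prod>j\<in>K. x - z j) > 0"
proof -
  have "(-1) ^ card {j \<in> K. i < j} = (\<Prod>j\<in>K. if i < j then -1 else 1 :: real)"
    using assms(1) by (simp add: prod.If_cases Int_def)
  then have "(-1) ^ card {j \<in> K. i < j} * (\<Prod>j\<in>K. x - z j)
      = (\<Prod>j\<in>K. (if i < j then -1 else 1) * (x - z j))"
    by (simp add: prod.distrib)
  also have "\<dots> > 0"
  proof (rule prod_pos)
    fix j assume "j \<in> K"
    then show "(if i < j then -1 else 1) * (x - z j) > 0"
      using assms(2,3)[of j] by (cases "i < j") auto
  qed
  finally show ?thesis .
qed

text \<open>Of the \<open>g + 1 - i\<close> indices above \<open>i\<close>, the omission of
  \<open>k\<close> and \<open>l\<close> removes two, one or none. It removes exactly one when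
  \<open>k \<le> i < l\<close>, so the parity differs just there.\<close>

lemma card_omit_two_sign:
  fixes g i k l :: nat
  assumes "1 \<le> k" "k < l" "l \<le> g + 1" "i \<le> g"
  shows "(-1) ^ card {j \<in> {1..g+1} - {k, l}. i < j}
     = (-1 :: real) ^ (g + i) * (if k \<le> i \<and> i < l then 1 else -1)"
proof -
  have *: "{j \<in> {1..g+1} - {k, l}. i < j} = {i+1..g+1} - ({k, l} \<inter> {i+1..g+1})" by auto
  have "card {j \<in> {1..g+1} - {k, l}. i < j} = (g + 1 - i) - card ({k, l} \<inter> {i+1..g+1})"
    unfolding * by (subst card_Diff_subset) auto
  moreover have "{k, l} \<inter> {i+1..g+1} = (if i < k then {k, l} else if i < l then {l} else {})"
    using assms by auto
  ultimately have c: "card {j \<in> {1..g+1} - {k, l}. i < j}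
      = (g + 1 - i) - (if i < k then 2 else if i < l then 1 else 0)"
    using assms by auto
  have s: "(-1 :: real) ^ a = (-1) ^ b" if "even a = even b" for a b
    using that by (metis neg_one_even_power neg_one_odd_power)
  consider "i < k" | "k \<le> i" "i < l" | "l \<le> i" by linarith
  then show ?thesis
  proof cases
    case 1
    then have "(-1 :: real) ^ (g + 1 - i - 2) = (-1) ^ (g + i + 1)"
      using assms by (intro s) auto
    then show ?thesis unfolding c using 1 by simp
  next
    case 2
    then have "(-1 :: real) ^ (g + 1 - i - 1) = (-1) ^ (g + i)"
      using assms by (intro s) auto
    then show ?thesis unfolding c using 2 by simp
  next
    case 3
    then have "(-1 :: real) ^ (g + 1 - i) = (-1) ^ (g + i + 1)"
      using assms by (intro s) auto
    then show ?thesis unfolding c using 3 assms by simp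
  qed
qed

text \<open>An even number of branch points lies to the right of a cut, so the phase is real there;
  to the right of a gap the number is odd and the phase is imaginary.\<close>

lemma neg_i_power_cut:
  assumes "k \<in> {1..g}" shows "(- \<i>) ^ (2*g+1-(2*k-1)) = - ((-1) ^ (g + k))"
proof -
  have n: "2*g+1-(2*k-1) = 2 * (g + 1 - k)" using assms by auto
  have "(-1 :: complex) ^ (g + 1 - k) = (-1) ^ (g + k + 1)"
    using assms by (intro minus_one_power_iff[THEN trans] minus_one_power_iff[THEN trans, symmetric]) auto
  then show ?thesis unfolding n by (simp add: power_mult)
qed

lemma neg_i_power_gap:
  assumes "k \<in> {1..g}" shows "(- \<i>) ^ (2*g+1-2*k) = - \<i> * (-1) ^ (g + k)"
proof -
  have n: "2*g+1-2*k = 2 * (g - k) + 1" using assms by auto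
  have "(-1 :: complex) ^ (g - k) = (-1) ^ (g + k)"
    using assms by (intro minus_one_power_iff[THEN trans] minus_one_power_iff[THEN trans, symmetric]) auto
  then show ?thesis unfolding n by (simp add: power_mult)
qed

section \<open>Cut and gap integrals, and the splitting of the integral along the real axis\<close>

context branch_points
begin

abbreviation wint :: "real poly \<Rightarrow> real \<Rightarrow> real \<Rightarrow> real" where
  "wint p a b \<equiv> integral {a..b} (\<lambda>x. poly p x * weight x)"

text \<open>The factor \<open>(-1) ^ (g + k)\<close> absorbs the phase of the square root. Up to one
  global sign, \<open>cut_int\<close> gives the a-periods, and \<open>\<i>\<close> times
  \<open>gap_int\<close> the contributions of single gaps to the b-periods.\<close>

definition cut_int :: "real poly \<Rightarrow> nat \<Rightarrow> real" where
  "cut_int p k = (-1) ^ (g + k) * wint p (e (2*k-1)) (e (2*k))"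

definition gap_int :: "real poly \<Rightarrow> nat \<Rightarrow> real" where
  "gap_int p k = (-1) ^ (g + k) * wint p (e (2*k)) (e (2*k+1))"

lemma integrable_poly_weight: "(\<lambda>x. poly p x * weight x) integrable_on {a..b}"
  by (intro integrable_weight continuous_intros)

lemma wint_add: "wint (p + q) a b = wint p a b + wint q a b"
  by (simp add: distrib_right integral_add integrable_poly_weight)

lemma wint_smult: "wint (smult c p) a b = c * wint p a b"
  by (simp add: mult.assoc)

lemma wint_pos:
  assumes "a < b" "E \<inter> {a<..<b} = {}" "\<And>x. a < x \<Longrightarrow> x < b \<Longrightarrow> s * poly p x > 0"
  shows "s * wint p a b > 0"
proof -
  have "integral {a..b} (\<lambda>x. poly (smult s p) x * weight x) > 0"
  proof (rule integral_pos_interior)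
    show "continuous_on {a<..<b} (\<lambda>x. poly (smult s p) x * weight x)"
      unfolding weight_def using assms(2) by (intro continuous_intros) auto
    fix x assume x: "a < x" "x < b"
    then have "weight x > 0" using assms(2) by (intro weight_pos) auto
    then show "poly (smult s p) x * weight x > 0" using assms(3)[OF x] by simp
  qed (rule assms integrable_poly_weight)+
  then show ?thesis by (simp only: wint_smult)
qed

lemma roots_above_between:
  assumes "j \<in> {1..2*g}" "e j < x" "x < e (j+1)"
  shows "roots_above x = 2 * g + 1 - j"
proof -
  have "x < e i \<longleftrightarrow> j < i" if "i \<in> J" for i
    using assms that e_le[of i j] e_le[of "j+1" i] by (cases "i \<le> j") (auto simp: J_def)
  then have "{i \<in> J. x < e i} = {i \<in> J. j < i}" by blast
  also have "\<dots> = {j+1..2*g+1}" by (auto simp: J_def)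
  finally show ?thesis by (simp add: roots_above_def)
qed

lemma roots_above_first:
  assumes "x < e 1" shows "roots_above x = 2 * g + 1"
proof -
  have "x < e i" if "i \<in> J" for i
    using assms that e_le[of 1 i] by (auto simp: J_def)
  then have "{i \<in> J. x < e i} = J" by blast
  then show ?thesis by (simp add: roots_above_def J_def)
qed

lemma roots_above_last:
  assumes "e (2*g+1) < x" shows "roots_above x = 0"
proof -
  have "\<not> x < e i" if "i \<in> J" for i
    using assms that e_le[of i "2*g+1"] by (auto simp: J_def)
  then have "{i \<in> J. x < e i} = {}" by blast
  then show ?thesis by (simp only: roots_above_def card.empty)
qed

lemma no_branch_point_between:
  assumes "j \<in> {1..2*g}"
  shows "E \<inter> {e j<..<e (j+1)} = {}"
proof -
  have "e i \<notin> {e j<..<e (j+1)}" if "i \<in> J" for i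
    using assms that e_le[of i j] e_le[of "j+1" i] by (cases "i \<le> j") (auto simp: J_def)
  then show ?thesis by blast
qed

lemma bdry_form_has_integral:
  assumes "\<And>x. a < x \<Longrightarrow> x < b \<Longrightarrow> roots_above x = n"
  shows "(bdry_form p has_integral (- \<i>) ^ n * of_real (wint p a b)) {a..b}"
proof -
  have "((\<lambda>x. complex_of_real (poly p x * weight x)) has_integral of_real (wint p a b)) {a..b}"
    using has_integral_linear[OF integrable_integral[OF integrable_poly_weight] bounded_linear_of_real]
    by (simp add: o_def)
  then have "((\<lambda>x. (- \<i>) ^ n * complex_of_real (poly p x * weight x)) has_integral (- \<i>) ^ n * of_real (wint p a b)) {a..b}"
    by (rule has_integral_mult_right)
  then show ?thesis
    unfolding box_real[symmetric]
    by (rule has_integral_spike_interior) (auto simp: bdry_form_def assms)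
qed

text \<open>The cuts and the right ray have real phase, the gaps and the left ray imaginary phase,
  so Cauchy's theorem splits into two separate real relations.\<close>

lemma bdry_form_integral:
  assumes T: "- T \<le> e 1" "e (2*g+1) \<le> T"
  shows "integral {-T..T} (bdry_form p)
    = of_real (wint p (e (2*g+1)) T - (\<Sum>k=1..g. cut_int p k))
      - \<i> * of_real ((-1) ^ g * wint p (-T) (e 1) + (\<Sum>k=1..g. gap_int p k))"
proof -
  let ?c = "\<lambda>j. (- \<i>) ^ (2*g+1-j) * of_real (wint p (e j) (e (j+1)))"
  have pieces: "(bdry_form p has_integral ((- \<i>) ^ (2*g+1) * of_real (wint p (-T) (e 1))
      + (\<Sum>j\<in>{1..<m}. ?c j))) {-T..e m}" if "1 \<le> m" "m \<le> 2*g+1" for m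
    using that
  proof (induction m rule: dec_induct)
    case base
    show ?case using bdry_form_has_integral[of "-T" "e 1" "2*g+1" p] roots_above_first by simp
  next
    case (step m)
    have "(bdry_form p has_integral ?c m) {e m..e (m+1)}"
      using step roots_above_between[of m] by (intro bdry_form_has_integral) auto
    then have "(bdry_form p has_integral ((- \<i>) ^ (2*g+1) * of_real (wint p (-T) (e 1))
      + (\<Sum>j\<in>{1..<m}. ?c j)) + ?c m) {-T..e (m+1)}"
      using step T e_le[of 1 m] e_le[of m "m+1"]
      by (intro has_integral_combine[of "-T" "e m" "e (m+1)"]) auto
    moreover have "(\<Sum>j\<in>{1..<Suc m}. ?c j) = (\<Sum>j\<in>{1..<m}. ?c j) + ?c m"
      using step by (intro sum.atLeastLessThan_Suc) auto
    ultimately show ?case by (simp only: add.assoc Suc_eq_plus1)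
  qed
  have "(bdry_form p has_integral of_real (wint p (e (2*g+1)) T)) {e (2*g+1)..T}"
    using bdry_form_has_integral[of "e (2*g+1)" T 0 p] roots_above_last by simp
  then have "(bdry_form p has_integral ((- \<i>) ^ (2*g+1) * of_real (wint p (-T) (e 1))
      + (\<Sum>j\<in>{1..<2*g+1}. ?c j)) + of_real (wint p (e (2*g+1)) T)) {-T..T}"
    using pieces[of "2*g+1"] T e_le[of 1 "2*g+1"]
    by (intro has_integral_combine[of "-T" "e (2*g+1)" T]) auto
  then have "integral {-T..T} (bdry_form p) = (- \<i>) ^ (2*g+1) * of_real (wint p (-T) (e 1))
      + (\<Sum>j\<in>{1..<2*g+1}. ?c j) + of_real (wint p (e (2*g+1)) T)"
    by (rule integral_unique)
  also have "(- \<i>) ^ (2*g+1) = - \<i> * of_real ((-1) ^ g)"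
    by (simp add: power_mult)
  also have "(\<Sum>j\<in>{1..<2*g+1}. ?c j) = (\<Sum>k=1..g. ?c (2*k-1)) + (\<Sum>k=1..g. ?c (2*k))"
    by (rule sum_odd_even)
  also have "(\<Sum>k=1..g. ?c (2*k-1)) = (\<Sum>k=1..g. - of_real (cut_int p k))"
  proof (rule sum.cong)
    fix k assume k: "k \<in> {1..g}"
    then have m: "2*k-1+1 = 2*k" by auto
    show "?c (2*k-1) = - of_real (cut_int p k)"
      unfolding m neg_i_power_cut[OF k] by (simp add: cut_int_def)
  qed simp
  also have "(\<Sum>k=1..g. ?c (2*k)) = (\<Sum>k=1..g. - \<i> * of_real (gap_int p k))"
  proof (rule sum.cong)
    fix k assume k: "k \<in> {1..g}"
    then show "?c (2*k) = - \<i> * of_real (gap_int p k)"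
      unfolding neg_i_power_gap[OF k] by (simp add: gap_int_def)
  qed simp
  finally show ?thesis
    by (simp add: sum_negf sum_distrib_left algebra_simps)
qed

text \<open>In the limit, the cut integrals add up to the integral over the infinite cut, and the
  gap integrals balance the left ray. The quantitative form with \<open>A / sqrt T\<close> avoids
  improper integrals.\<close>

lemma period_sum_bounds:
  assumes "degree p < g"
  obtains A r where "r \<ge> \<bar>e 1\<bar>" "r \<ge> \<bar>e (2*g+1)\<bar> + 1"
    "\<And>T. r \<le> T \<Longrightarrow> \<bar>wint p (e (2*g+1)) T - (\<Sum>k=1..g. cut_int p k)\<bar> \<le> A / sqrt T"
    "\<And>T. r \<le> T \<Longrightarrow> \<bar>(-1) ^ g * wint p (-T) (e 1) + (\<Sum>k=1..g. gap_int p k)\<bar> \<le> A / sqrt T"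
proof -
  obtain A r where A: "\<And>T. r \<le> T \<Longrightarrow> norm (integral {-T..T} (bdry_form p)) \<le> A / sqrt T"
    using bdry_form_integral_bound[OF assms] by metis
  define r' where "r' = Max {r, \<bar>e 1\<bar>, \<bar>e (2*g+1)\<bar> + 1}"
  have r': "r' \<ge> r" "r' \<ge> \<bar>e 1\<bar>" "r' \<ge> \<bar>e (2*g+1)\<bar> + 1" by (auto simp: r'_def)
  have b: "norm (of_real u - \<i> * of_real v) \<le> B \<Longrightarrow> \<bar>u\<bar> \<le> B \<and> \<bar>v\<bar> \<le> B" for u v B :: real
    using abs_Re_le_cmod[of "of_real u - \<i> * of_real v"] abs_Im_le_cmod[of "of_real u - \<i> * of_real v"] by simp
  have "\<bar>wint p (e (2*g+1)) T - (\<Sum>k=1..g. cut_int p k)\<bar> \<le> A / sqrt T \<and>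
        \<bar>(-1) ^ g * wint p (-T) (e 1) + (\<Sum>k=1..g. gap_int p k)\<bar> \<le> A / sqrt T" if "r' \<le> T" for T
  proof (rule b)
    have "- T \<le> e 1" "e (2*g+1) \<le> T" "r \<le> T" using that r' by linarith+
    then show "norm (complex_of_real (wint p (e (2*g+1)) T - (\<Sum>k=1..g. cut_int p k)) - \<i> *
       complex_of_real ((-1) ^ g * wint p (-T) (e 1) + (\<Sum>k=1..g. gap_int p k))) \<le> A / sqrt T"
      using A[of T] bdry_form_integral[of T p] by simp
  qed
  then show ?thesis using r' by (intro that[of r' A]) auto
qed

end

section \<open>Sign patterns and positivity of the period matrix\<close>

lemma le_zero_of_le_div_sqrt:
  assumes "\<And>T. r \<le> T \<Longrightarrow> c \<le> A / sqrt T"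
  shows "c \<le> 0"
proof -
  have "((\<lambda>T. A / sqrt T) \<longlongrightarrow> 0) at_top"
    by (intro tendsto_divide_0[OF tendsto_const] filterlim_at_top_imp_at_infinity sqrt_at_top)
  moreover have "\<forall>\<^sub>F T in at_top. c \<le> A / sqrt T"
    using assms unfolding eventually_at_top_linorder by blast
  ultimately show ?thesis by (rule tendsto_lowerbound) simp
qed

lemma poly_constant_sign:
  fixes p :: "real poly"
  assumes "connected S" "\<And>x. x \<in> S \<Longrightarrow> poly p x \<noteq> 0"
  shows "\<exists>s. \<bar>s\<bar> = 1 \<and> (\<forall>x\<in>S. s * poly p x > 0)"
proof -
  have "connected (poly p ` S)"
    using assms(1) by (intro connected_continuous_image continuous_intros)
  then have iv: "is_interval (poly p ` S)" by (simp add: is_interval_connected_1)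
  have nz: "0 \<notin> poly p ` S" using assms(2) by force
  have "(\<forall>x\<in>S. poly p x > 0) \<or> (\<forall>x\<in>S. poly p x < 0)"
  proof (rule ccontr)
    assume "\<not> ?thesis"
    then obtain x y where xy: "x \<in> S" "poly p x \<le> 0" "y \<in> S" "0 \<le> poly p y" by (auto simp: not_less)
    have "0 \<in> poly p ` S"
      by (rule mem_is_interval_1_I[OF iv imageI[OF xy(1)] imageI[OF xy(3)] xy(2,4)])
    with nz show False ..
  qed
  then show ?thesis
  proof
    assume "\<forall>x\<in>S. poly p x > 0"
    then show ?thesis by (intro exI[of _ 1]) auto
  next
    assume "\<forall>x\<in>S. poly p x < 0"
    then show ?thesis by (intro exI[of _ "-1"]) auto
  qed
qed

text \<open>Writing \<open>2 * X i * X k\<close> as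
  \<open>(X i)\<^sup>2 + (X k)\<^sup>2 - (X i - X k)\<^sup>2\<close> turns twice the form into row
  sums, column sums and a remainder in which the diagonal cancels and all other terms have a
  favourable sign.\<close>

lemma row_col_sums_imp_pos:
  fixes N :: "'a \<Rightarrow> 'a \<Rightarrow> real"
  assumes "finite K"
    and off: "\<And>i k. i \<in> K \<Longrightarrow> k \<in> K \<Longrightarrow> i \<noteq> k \<Longrightarrow> N i k \<le> 0"
    and row: "\<And>i. i \<in> K \<Longrightarrow> (\<Sum>k\<in>K. N i k) > 0"
    and col: "\<And>k. k \<in> K \<Longrightarrow> (\<Sum>i\<in>K. N i k) \<ge> 0"
    and X: "j \<in> K" "X j \<noteq> 0"
  shows "(\<Sum>i\<in>K. \<Sum>k\<in>K. X i * N i k * X k) > 0"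
proof -
  have "2 * (\<Sum>i\<in>K. \<Sum>k\<in>K. X i * N i k * X k)
      = (\<Sum>i\<in>K. \<Sum>k\<in>K. (X i)\<^sup>2 * N i k + (X k)\<^sup>2 * N i k - N i k * (X i - X k)\<^sup>2)"
    by (simp add: sum_distrib_left power2_eq_square algebra_simps)
  also have "\<dots> = (\<Sum>i\<in>K. (X i)\<^sup>2 * (\<Sum>k\<in>K. N i k)) + (\<Sum>i\<in>K. \<Sum>k\<in>K. (X k)\<^sup>2 * N i k)
      - (\<Sum>i\<in>K. \<Sum>k\<in>K. N i k * (X i - X k)\<^sup>2)"
    by (simp add: sum.distrib sum_subtractf sum_distrib_left)
  also have "(\<Sum>i\<in>K. \<Sum>k\<in>K. (X k)\<^sup>2 * N i k) = (\<Sum>k\<in>K. (X k)\<^sup>2 * (\<Sum>i\<in>K. N i k))"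
    by (subst sum.swap) (simp add: sum_distrib_left)
  finally have eq: "2 * (\<Sum>i\<in>K. \<Sum>k\<in>K. X i * N i k * X k) = (\<Sum>i\<in>K. (X i)\<^sup>2 * (\<Sum>k\<in>K. N i k))
      + (\<Sum>k\<in>K. (X k)\<^sup>2 * (\<Sum>i\<in>K. N i k)) - (\<Sum>i\<in>K. \<Sum>k\<in>K. N i k * (X i - X k)\<^sup>2)" .
  have "(\<Sum>i\<in>K. (X i)\<^sup>2 * (\<Sum>k\<in>K. N i k)) > 0"
    using X row \<open>finite K\<close> by (intro sum_pos2[of K j]) (auto simp: less_imp_le[OF row])
  moreover have "(\<Sum>k\<in>K. (X k)\<^sup>2 * (\<Sum>i\<in>K. N i k)) \<ge> 0"
  proof (rule sum_nonneg)
    show "(X k)\<^sup>2 * (\<Sum>i\<in>K. N i k) \<ge> 0" if "k \<in> K" for k using col[OF that] by simp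
  qed
  moreover have "N i k * (X i - X k)\<^sup>2 \<le> 0" if "i \<in> K" "k \<in> K" for i k
    using off[OF that] by (cases "i = k") (auto simp: mult_nonpos_nonneg)
  then have "(\<Sum>i\<in>K. \<Sum>k\<in>K. N i k * (X i - X k)\<^sup>2) \<le> 0"
    by (intro sum_nonpos) auto
  ultimately show ?thesis using eq by linarith
qed

context branch_points
begin

text \<open>Without a zero, \<open>p\<close> would have constant sign on the interval and
  \<open>wint_pos\<close> would apply.\<close>

lemma wint_eq_0_root:
  assumes "a < b" "E \<inter> {a<..<b} = {}" "wint p a b = 0"
  shows "\<exists>z. a < z \<and> z < b \<and> poly p z = 0"
proof (rule ccontr)
  assume no: "\<not> ?thesis"
  have "connected {a<..<b}" by simp
  moreover have "poly p x \<noteq> 0" if "x \<in> {a<..<b}" for x using no that by auto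
  ultimately obtain s where "\<bar>s\<bar> = 1" "\<And>x. x \<in> {a<..<b} \<Longrightarrow> s * poly p x > 0"
    using poly_constant_sign[of "{a<..<b}" p] by metis
  then have "s * wint p a b > 0"
    using assms by (intro wint_pos) auto
  then show False using assms(3) by simp
qed

lemma cut_less: "k \<in> {1..g} \<Longrightarrow> e (2*k-1) < e (2*k)"
  by (intro e_less) auto

lemma gap_less: "k \<in> {1..g} \<Longrightarrow> e (2*k) < e (2*k+1)"
  by (intro e_less) auto

lemma cut_no_branch_point:
  assumes "k \<in> {1..g}" shows "E \<inter> {e (2*k-1)<..<e (2*k)} = {}"
proof -
  have "2 * k - 1 \<in> {1..2*g}" "2 * k - 1 + 1 = 2 * k" using assms by auto
  then show ?thesis using no_branch_point_between[of "2*k-1"] by metis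
qed

lemma cut_int_root:
  assumes "k \<in> {1..g}" "cut_int p k = 0"
  shows "\<exists>z. e (2*k-1) < z \<and> z < e (2*k) \<and> poly p z = 0"
  using wint_eq_0_root[OF cut_less cut_no_branch_point, of k p] assms by (simp add: cut_int_def)

text \<open>The integral over the infinite cut tends to \<open>0\<close>. If \<open>p\<close> had
  constant sign there, the positive contribution of the first unit interval would be a lower bound
  for all later partial integrals.\<close>

lemma last_root:
  assumes "degree p < g" "(\<Sum>k=1..g. cut_int p k) = 0"
  shows "\<exists>z. e (2*g+1) < z \<and> poly p z = 0"
proof (rule ccontr)
  let ?e = "e (2*g+1)"
  assume "\<not> ?thesis"
  then obtain s where s: "\<bar>s\<bar> = 1" "\<And>x. x \<in> {?e<..} \<Longrightarrow> s * poly p x > 0"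
    using poly_constant_sign[of "{?e<..}" p] by (metis connected_Ioi greaterThan_iff)
  have noE: "E \<inter> {?e<..<b} = {}" for b
    using e_le[of _ "2*g+1"] by (force simp: J_def)
  obtain A r where r: "r \<ge> \<bar>?e\<bar> + 1"
    and bd: "\<And>T. r \<le> T \<Longrightarrow> \<bar>wint p ?e T - (\<Sum>k=1..g. cut_int p k)\<bar> \<le> A / sqrt T"
    using period_sum_bounds[OF assms(1)] by metis
  have "s * wint p ?e (?e + 1) \<le> A / sqrt T" if T: "r + 1 \<le> T" for T
  proof -
    have T': "?e + 1 < T" using r T by linarith
    have "wint p ?e T = wint p ?e (?e + 1) + wint p (?e + 1) T"
      using T' by (intro Henstock_Kurzweil_Integration.integral_combine[symmetric] integrable_poly_weight) auto
    moreover have "s * wint p (?e + 1) T > 0"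
    proof (rule wint_pos)
      show "E \<inter> {?e + 1<..<T} = {}" using noE[of T] by auto
    qed (use T' s in auto)
    ultimately have "s * wint p ?e (?e + 1) \<le> s * wint p ?e T" by (simp add: distrib_left)
    also have "\<dots> \<le> \<bar>wint p ?e T\<bar>"
      using s(1) by (metis abs_ge_self abs_mult mult_1)
    also have "\<dots> \<le> A / sqrt T" using bd[of T] T assms(2) by simp
    finally show ?thesis .
  qed
  then have "s * wint p ?e (?e + 1) \<le> 0" by (rule le_zero_of_le_div_sqrt)
  moreover have "s * wint p ?e (?e + 1) > 0"
    using noE s by (intro wint_pos) auto
  ultimately show False by simp
qed

text \<open>In the imaginary part of Cauchy's theorem the gap integrals balance the left ray, whose
  sign is prescribed by \<open>neg\<close>.\<close>

lemma gap_sum_nonneg: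
  assumes "degree p < g" and neg: "\<And>x. x < e 1 \<Longrightarrow> (-1) ^ g * poly p x < 0"
  shows "(\<Sum>k=1..g. gap_int p k) \<ge> 0"
proof -
  have noE: "E \<inter> {a<..<e 1} = {}" for a
    using e_le[of 1] by (force simp: J_def)
  obtain A r where r: "r \<ge> \<bar>e 1\<bar>"
    and bd: "\<And>T. r \<le> T \<Longrightarrow> \<bar>(-1) ^ g * wint p (-T) (e 1) + (\<Sum>k=1..g. gap_int p k)\<bar> \<le> A / sqrt T"
    using period_sum_bounds[OF assms(1)] by metis
  have "- (\<Sum>k=1..g. gap_int p k) \<le> A / sqrt T" if T: "r + 1 \<le> T" for T
  proof -
    have "- ((-1) ^ g) * wint p (-T) (e 1) > 0"
      using r T neg noE by (intro wint_pos) auto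
    then show ?thesis using bd[of T] T by linarith
  qed
  then have "- (\<Sum>k=1..g. gap_int p k) \<le> 0" by (rule le_zero_of_le_div_sqrt)
  then show ?thesis by simp
qed

text \<open>
  The index \<open>g + 1\<close> stands for the infinite cut; by Cauchy's theorem its integral vanishes iff the
  other cut integrals sum to \<open>0\<close>.
\<close>

lemma period_signs:
  assumes deg: "degree p < g" and kl: "1 \<le> k" "k < l" "l \<le> g + 1"
    and zero: "\<And>j. j \<in> {1..g} - {k, l} \<Longrightarrow> cut_int p j = 0"
    and sum0: "l \<noteq> g + 1 \<Longrightarrow> (\<Sum>j=1..g. cut_int p j) = 0"
    and pos: "cut_int p k > 0"
  shows "\<And>i. i \<in> {1..g} \<Longrightarrow> k \<le> i \<Longrightarrow> i < l \<Longrightarrow> gap_int p i > 0"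
    and "\<And>i. i \<in> {1..g} \<Longrightarrow> \<not> (k \<le> i \<and> i < l) \<Longrightarrow> gap_int p i < 0"
    and "(\<Sum>i=1..g. gap_int p i) \<ge> 0"
proof -
  \<comment> \<open>The cuts, with the infinite one as \<open>g + 1\<close>, in which a root will be
    found. There are \<open>g - 1\<close> of them, the maximal degree of \<open>p\<close>, so these
    roots determine \<open>p\<close> up to a scalar.\<close>
  define K where "K = {1..g+1} - {k, l}"
  have finK: "finite K" and cardK: "card K = g - 1"
    using kl by (auto simp: K_def card_Diff_subset)
  \<comment> \<open>For \<open>j = g + 1\<close> the left end \<open>e (2*j-1)\<close> is the last
    branch point, and there is no right end.\<close>
  have "\<exists>z. e (2*j-1) < z \<and> (j \<le> g \<longrightarrow> z < e (2*j)) \<and> poly p z = 0" if "j \<in> K" for j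
  proof (cases "j \<le> g")
    case True
    then show ?thesis using that cut_int_root[of j p] zero[of j] by (auto simp: K_def)
  next
    case False
    then have "j = g + 1" using that by (auto simp: K_def)
    then show ?thesis using that last_root[OF deg sum0] by (auto simp: K_def)
  qed
  then obtain z where z: "\<And>j. j \<in> K \<Longrightarrow> e (2*j-1) < z j" "\<And>j. j \<in> K \<Longrightarrow> j \<le> g \<Longrightarrow> z j < e (2*j)"
    "\<And>j. j \<in> K \<Longrightarrow> poly p (z j) = 0"
    by metis
  have right: "e (2*i+1) < z j" if "j \<in> K" "i < j" for i j
  proof -
    have "e (2*i+1) \<le> e (2*j-1)" using that by (intro e_le) (auto simp: K_def)
    then show ?thesis using z(1)[OF that(1)] by linarith
  qed
  have left: "z j < e (2*i)" if "j \<in> K" "j \<le> i" "i \<le> g" for i j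
  proof -
    have "e (2*j) \<le> e (2*i)" using that by (intro e_le) (auto simp: K_def)
    then show ?thesis using z(2)[OF that(1)] that by linarith
  qed
  have left1: "z j < e (2*i-1)" if "j \<in> K" "j < i" "i \<le> g" for i j
  proof -
    have "e (2*j) \<le> e (2*i-1)" using that by (intro e_le) (auto simp: K_def)
    then show ?thesis using z(2)[OF that(1)] that by linarith
  qed
  have zless: "z i < z j" if "i \<in> K" "j \<in> K" "i < j" for i j
  proof -
    have "i \<le> g" "1 \<le> i" using that by (auto simp: K_def)
    then show ?thesis
      using left[OF that(1), of i] right[OF that(2,3)] e_less[of "2*i" "2*i+1"] by simp
  qed
  have inj: "inj_on z K"
    by (rule inj_onI) (metis linorder_neqE_nat order_less_irrefl zless)
  define c where "c = coeff p (g - 1)"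
  have "p = smult c (\<Prod>j\<in>K. [:- z j, 1:])"
    unfolding c_def cardK[symmetric] using deg cardK z inj by (intro poly_eq_prod_roots finK) auto
  then have p: "poly p x = c * (\<Prod>j\<in>K. x - z j)" for x
    by (subst \<open>p = _\<close>) (simp add: poly_prod)
  \<comment> \<open>Passing a cut in \<open>K\<close> flips the sign of the product and also that of
    \<open>(-1) ^ (g + i)\<close>, so these cancel. The combined sign \<open>\<sigma>\<close>
    changes only at the cuts \<open>k\<close> and \<open>l\<close>.\<close>
  define \<sigma> :: "nat \<Rightarrow> real" where "\<sigma> i = (if k \<le> i \<and> i < l then 1 else -1)" for i
  have sgn: "\<sigma> i * (-1) ^ (g + i) * (\<Prod>j\<in>K. x - z j) > 0"
    if "i \<le> g" "\<And>j. j \<in> K \<Longrightarrow> i < j \<Longrightarrow> x < z j" "\<And>j. j \<in> K \<Longrightarrow> \<not> i < j \<Longrightarrow> z j < x" for i x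
  proof -
    have "(-1) ^ card {j \<in> K. i < j} * (\<Prod>j\<in>K. x - z j) > 0"
      using that by (intro sign_prod_roots finK) (metis less_irrefl, metis less_asym)
    then show ?thesis
      using card_omit_two_sign[OF kl that(1)] by (simp add: K_def \<sigma>_def mult_ac)
  qed
  have kg: "k \<in> {1..g}" using kl by auto
  \<comment> \<open>On cut \<open>k\<close> the signed product is positive, so \<open>pos\<close>
    will force the scalar \<open>c\<close> to be positive.\<close>
  have W: "(-1) ^ (g + k) * wint (\<Prod>j\<in>K. [:- z j, 1:]) (e (2*k-1)) (e (2*k)) > 0"
  proof (rule wint_pos)
    show "e (2*k-1) < e (2*k)" by (rule cut_less[OF kg])
    show "E \<inter> {e (2*k-1)<..<e (2*k)} = {}" by (rule cut_no_branch_point[OF kg])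
    fix x assume x: "e (2*k-1) < x" "x < e (2*k)"
    have "\<sigma> k * (-1) ^ (g + k) * (\<Prod>j\<in>K. x - z j) > 0"
    proof (rule sgn)
      fix j assume j: "j \<in> K"
      show "k < j \<Longrightarrow> x < z j" using right[OF j, of k] x kl e_less[of "2*k" "2*k+1"] by simp
      have "j \<noteq> k" using j by (auto simp: K_def)
      then show "\<not> k < j \<Longrightarrow> z j < x" using left1[OF j, of k] x kg by simp
    qed (use kg in auto)
    then show "(-1) ^ (g + k) * poly (\<Prod>j\<in>K. [:- z j, 1:]) x > 0"
      using kl by (simp add: \<sigma>_def poly_prod)
  qed
  have cut: "cut_int p k = c * ((-1) ^ (g + k) * wint (\<Prod>j\<in>K. [:- z j, 1:]) (e (2*k-1)) (e (2*k)))"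
    by (subst \<open>p = _\<close>) (simp only: cut_int_def wint_smult mult.left_commute)
  have c: "c > 0" using pos[unfolded cut] W by (rule zero_less_mult_pos2)
  have gap: "\<sigma> i * gap_int p i > 0" if i: "i \<in> {1..g}" for i
  proof -
    have "\<sigma> i * (-1) ^ (g + i) * wint p (e (2*i)) (e (2*i+1)) > 0"
    proof (rule wint_pos)
      show "e (2*i) < e (2*i+1)" by (rule gap_less[OF i])
      show "E \<inter> {e (2*i)<..<e (2*i+1)} = {}" using no_branch_point_between[of "2*i"] i by auto
      fix x assume x: "e (2*i) < x" "x < e (2*i+1)"
      have "\<sigma> i * (-1) ^ (g + i) * (\<Prod>j\<in>K. x - z j) > 0"
      proof (rule sgn)
        fix j assume j: "j \<in> K"
        show "i < j \<Longrightarrow> x < z j" using right[OF j, of i] x by simp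
        show "\<not> i < j \<Longrightarrow> z j < x" using left[OF j, of i] x i by simp
      qed (use i in auto)
      then have "c * (\<sigma> i * (-1) ^ (g + i) * (\<Prod>j\<in>K. x - z j)) > 0"
        using c by (rule mult_pos_pos[rotated])
      then show "\<sigma> i * (-1) ^ (g + i) * poly p x > 0"
        by (simp add: p mult_ac)
    qed
    then show ?thesis by (simp add: gap_int_def mult_ac)
  qed
  show "gap_int p i > 0" if "i \<in> {1..g}" "k \<le> i" "i < l" for i
    using gap[OF that(1)] that by (simp add: \<sigma>_def)
  show "gap_int p i < 0" if "i \<in> {1..g}" "\<not> (k \<le> i \<and> i < l)" for i
    using gap[OF that(1)] that(2) by (simp add: \<sigma>_def split: if_splits)
  show "(\<Sum>i=1..g. gap_int p i) \<ge> 0"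
  proof (rule gap_sum_nonneg[OF deg])
    fix x assume x: "x < e 1"
    \<comment> \<open>The ray to the left of \<open>e 1\<close> plays the part of a gap with index
      \<open>0\<close>, and \<open>\<sigma> 0 = -1\<close> because \<open>k \<ge> 1\<close>.\<close>
    have "\<sigma> 0 * (-1) ^ (g + 0) * (\<Prod>j\<in>K. x - z j) > 0"
    proof (rule sgn)
      fix j assume j: "j \<in> K"
      show "0 < j \<Longrightarrow> x < z j" using right[OF j, of 0] x by simp
      show "\<not> 0 < j \<Longrightarrow> z j < x" using j by (auto simp: K_def)
    qed auto
    then have "c * (\<sigma> 0 * (-1) ^ (g + 0) * (\<Prod>j\<in>K. x - z j)) > 0"
      using c by (rule mult_pos_pos[rotated])
    then show "(-1) ^ g * poly p x < 0"
      using kl by (simp add: p \<sigma>_def mult_ac)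
  qed
qed

end

section \<open>Positivity of the pairing of a-periods with b-periods\<close>

text \<open>The b-periods are tails of gap integrals; the exchange moves the summation to the cut
  integrals, whose partial sums are the coordinates used in \<open>cut_gap_pos\<close>.\<close>

lemma sum_triangle_swap:
  fixes a b :: "nat \<Rightarrow> real"
  shows "(\<Sum>k=1..n. a k * (\<Sum>i=k..n. b i)) = (\<Sum>i=1..n. (\<Sum>k=1..i. a k) * b i)"
proof (induction n)
  case (Suc n)
  have "(\<Sum>k=1..n. a k * (\<Sum>i=k..Suc n. b i)) = (\<Sum>k=1..n. a k * (\<Sum>i=k..n. b i) + a k * b (Suc n))"
    by (intro sum.cong) (auto simp: distrib_left)
  then show ?case using Suc by (simp add: sum.distrib sum_distrib_right distrib_right)
qed simp

context branch_points
begin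

lemma cut_int_add: "cut_int (p + q) k = cut_int p k + cut_int q k"
  unfolding cut_int_def wint_add by (simp only: distrib_left)

lemma gap_int_add: "gap_int (p + q) k = gap_int p k + gap_int q k"
  unfolding gap_int_def wint_add by (simp only: distrib_left)

lemma cut_int_smult: "cut_int (smult c p) k = c * cut_int p k"
  unfolding cut_int_def wint_smult by (simp only: mult.left_commute)

lemma gap_int_smult: "gap_int (smult c p) k = c * gap_int p k"
  unfolding gap_int_def wint_smult by (simp only: mult.left_commute)

lemma cut_int_0: "cut_int 0 k = 0"
  by (simp add: cut_int_def)

lemma gap_int_0: "gap_int 0 k = 0"
  by (simp add: gap_int_def)

lemma cut_int_sum: "cut_int (\<Sum>j\<in>K. f j) k = (\<Sum>j\<in>K. cut_int (f j) k)"
  by (induction K rule: infinite_finite_induct) (simp_all add: cut_int_0 cut_int_add)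

lemma gap_int_sum: "gap_int (\<Sum>j\<in>K. f j) k = (\<Sum>j\<in>K. gap_int (f j) k)"
  by (induction K rule: infinite_finite_induct) (simp_all add: gap_int_0 gap_int_add)

text \<open>A root in each of \<open>g\<close> disjoint cuts is too much for degree less than
  \<open>g\<close>. This is the nonsingularity of the a-periods.\<close>

lemma cut_ints_eq_0:
  assumes "degree p < g" and zero: "\<And>k. k \<in> {1..g} \<Longrightarrow> cut_int p k = 0"
  shows "p = 0"
proof (rule ccontr)
  assume p: "p \<noteq> 0"
  have "\<forall>k\<in>{1..g}. \<exists>z. e (2*k-1) < z \<and> z < e (2*k) \<and> poly p z = 0"
    using cut_int_root zero by blast
  then obtain z where "\<forall>k\<in>{1..g}. e (2*k-1) < z k \<and> z k < e (2*k) \<and> poly p (z k) = 0"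
    by metis
  then have z: "e (2*k-1) < z k \<and> z k < e (2*k) \<and> poly p (z k) = 0" if "k \<in> {1..g}" for k
    using that by blast
  have "z i < z j" if "i \<in> {1..g}" "j \<in> {1..g}" "i < j" for i j
  proof -
    have "e (2*i) < e (2*j-1)" using that by (intro e_less) auto
    then show ?thesis using z[OF that(1)] z[OF that(2)] by linarith
  qed
  then have "inj_on z {1..g}"
    by (intro inj_onI) (metis linorder_neqE_nat order_less_irrefl)
  then have "g = card (z ` {1..g})" by (simp add: card_image)
  also have "\<dots> \<le> card {x. poly p x = 0}"
    using z by (intro card_mono poly_roots_finite p) auto
  also have "\<dots> \<le> degree p" using p by (rule card_poly_roots_bound)
  finally show False using assms(1) by simp
qed

text \<open>The positivity in Riemann's bilinear relations, for one real numerator \<open>p\<close>.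
  The hypothesis \<open>surj\<close> is supplied by \<open>cut_ints_surj\<close>.\<close>

lemma cut_gap_pos:
  assumes surj: "\<And>a. \<exists>q. degree q < g \<and> (\<forall>k\<in>{1..g}. cut_int q k = a k)"
    and p: "degree p < g" "p \<noteq> 0"
  shows "(\<Sum>k=1..g. cut_int p k * (\<Sum>i=k..g. gap_int p i)) > 0"
proof -
  have g: "g \<ge> 1" using p by simp
  \<comment> \<open>The partial sums are the coordinates of \<open>p\<close> in the basis
    \<open>q\<close>, since \<open>X j - X (j - 1)\<close> is the \<open>j\<close>-th cut
    integral.\<close>
  define X where "X i = (\<Sum>k=1..i. cut_int p k)" for i
  \<comment> \<open>For \<open>k = g\<close> the entry \<open>-1\<close> would belong to the
    infinite cut, so only the entry \<open>1\<close> is visible.\<close>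
  obtain q where q: "\<And>k. degree (q k) < g"
    "\<And>k j. j \<in> {1..g} \<Longrightarrow> cut_int (q k) j = (if j = k then 1 else if j = k + 1 then -1 else 0)"
    using surj[of "\<lambda>j. if j = k then 1 else if j = k + 1 then -1 else 0" for k] by metis
  define N where "N i k = gap_int (q k) i" for i k
  have pq: "p = (\<Sum>k=1..g. smult (X k) (q k))"
  proof -
    have "p - (\<Sum>k=1..g. smult (X k) (q k)) = 0"
    proof (rule cut_ints_eq_0)
      show "degree (p - (\<Sum>k=1..g. smult (X k) (q k))) < g"
        using g p q by (intro degree_diff_less degree_sum_less) (auto intro: le_less_trans[OF degree_smult_le])
      fix j assume j: "j \<in> {1..g}"
      have "cut_int (\<Sum>k=1..g. smult (X k) (q k)) j
          = (\<Sum>k=1..g. X k * (if j = k then 1 else if j = k + 1 then -1 else 0))"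
        using j q(2) by (simp add: cut_int_sum cut_int_smult)
      also have "\<dots> = (\<Sum>k=1..g. (if j = k then X k else 0) - (if k = j - 1 then X k else 0))"
        using j by (intro sum.cong) auto
      also have "\<dots> = X j - (if j = 1 then 0 else X (j - 1))"
        using j by (auto simp: sum_subtractf)
      also have "\<dots> = cut_int p j"
        using j by (cases j) (auto simp: X_def)
      finally show "cut_int (p - (\<Sum>k=1..g. smult (X k) (q k))) j = 0"
        using cut_int_add[of "p - (\<Sum>k=1..g. smult (X k) (q k))" "\<Sum>k=1..g. smult (X k) (q k)" j] by simp
    qed
    then show ?thesis by simp
  qed
  \<comment> \<open>The entries \<open>1\<close> and \<open>-1\<close> cancel when both lie in
    \<open>{1..g}\<close>, as \<open>period_signs\<close> demands for
    \<open>l \<noteq> g + 1\<close>.\<close>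
  have sum_q: "(\<Sum>j=1..g. cut_int (q k) j) = 0" if "k \<in> {1..g}" "k + 1 \<noteq> g + 1" for k
  proof -
    have "(\<Sum>j=1..g. cut_int (q k) j) = (\<Sum>j=1..g. (if j = k then 1 else 0) - (if j = k + 1 then 1 else 0))"
      using q(2) by (intro sum.cong) auto
    then show ?thesis using that by (simp add: sum_subtractf)
  qed
  have q_signs: "i \<in> {1..g} \<Longrightarrow> i \<noteq> k \<Longrightarrow> N i k < 0" "(\<Sum>i=1..g. N i k) \<ge> 0" if k: "k \<in> {1..g}" for i k
  proof -
    have "\<not> (k \<le> i \<and> i < k + 1)" if "i \<noteq> k" using that by auto
    then show "i \<in> {1..g} \<Longrightarrow> i \<noteq> k \<Longrightarrow> N i k < 0"
      unfolding N_def using k q sum_q by (intro period_signs(2)[of "q k" k "k+1"]) auto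
    show "(\<Sum>i=1..g. N i k) \<ge> 0"
      unfolding N_def using k q sum_q by (intro period_signs(3)[of "q k" k "k+1"]) auto
  qed
  have row: "(\<Sum>k=1..g. N i k) > 0" if i: "i \<in> {1..g}" for i
  proof -
    \<comment> \<open>The sum of all \<open>q k\<close> telescopes to the cut integrals
      \<open>1, 0, ..., 0\<close>; \<open>period_signs\<close> with the cuts \<open>1\<close> and
      \<open>g + 1\<close> then makes every gap integral positive.\<close>
    define r where "r = (\<Sum>k=1..g. q k)"
    have r: "cut_int r j = (if j = 1 then 1 else 0)" if "j \<in> {1..g}" for j
    proof -
      have "cut_int r j = (\<Sum>k=1..g. (if j = k then 1 else 0) - (if k = j - 1 then 1 else 0))"
        unfolding r_def cut_int_sum using q(2) that by (intro sum.cong) auto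
      then show ?thesis using that by (auto simp: sum_subtractf)
    qed
    have "degree r < g" unfolding r_def using q g by (intro degree_sum_less) auto
    then have "gap_int r i > 0"
      using i g r by (intro period_signs(1)[of r 1 "g+1"]) auto
    then show ?thesis by (simp add: r_def gap_int_sum N_def)
  qed
  have "\<exists>j\<in>{1..g}. X j \<noteq> 0"
  proof (rule ccontr)
    assume "\<not> ?thesis"
    then have "p = 0" by (subst pq) simp
    then show False using p by simp
  qed
  then obtain j where j: "j \<in> {1..g}" "X j \<noteq> 0" by blast
  have gp: "gap_int p i = (\<Sum>k=1..g. X k * N i k)" for i
    by (subst pq) (simp add: gap_int_sum gap_int_smult N_def)
  have "(\<Sum>k=1..g. cut_int p k * (\<Sum>i=k..g. gap_int p i)) = (\<Sum>i=1..g. X i * gap_int p i)"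
    unfolding X_def by (rule sum_triangle_swap)
  also have "\<dots> = (\<Sum>i=1..g. \<Sum>k=1..g. X i * N i k * X k)"
    by (simp add: gp sum_distrib_left mult_ac)
  also have "\<dots> > 0"
    using q_signs row j by (intro row_col_sums_imp_pos) (auto intro: less_imp_le)
  finally show ?thesis .
qed

end

section \<open>Period matrices over the index type\<close>

lemma idx_range: "idx (i :: 'n::{finite,linorder}) \<in> {1..CARD('n)}"
  using idx_bij[where 'n = 'n] by (auto simp: bij_betw_def)

lemma idx_inj: "idx i = idx j \<longleftrightarrow> i = (j :: 'n::{finite,linorder})"
  using idx_bij[where 'n = 'n] by (auto simp: bij_betw_def inj_on_def)

lemma idx_surj: "k \<in> {1..CARD('n)} \<Longrightarrow> \<exists>i :: 'n::{finite,linorder}. k = idx i"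
  using idx_bij[where 'n = 'n] unfolding bij_betw_def by blast

lemma all_idx_iff: "(\<forall>i :: 'n::{finite,linorder}. P (idx i)) \<longleftrightarrow> (\<forall>k\<in>{1..CARD('n)}. P k)"
proof -
  have "range (idx :: 'n \<Rightarrow> nat) = {1..CARD('n)}"
    using idx_bij[where 'n = 'n] by (simp only: bij_betw_def)
  then show ?thesis by (metis (no_types, lifting) rangeE rangeI)
qed

lemma matrix_inv_left: "invertible (A :: 'a::semiring_1^'n^'n) \<Longrightarrow> matrix_inv A ** A = mat 1"
  unfolding invertible_def matrix_inv_def by (rule someI2_ex) auto

lemma matrix_inv_eqI:
  assumes "B ** A = mat 1" shows "matrix_inv A = (B :: 'a::field^'n^'n)"
proof -
  have "invertible A" using assms by (auto simp: invertible_left_inverse)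
  then have "matrix_inv A = (B ** A) ** matrix_inv A" by (simp add: assms)
  also have "\<dots> = B ** (A ** matrix_inv A)" by (simp add: matrix_mul_assoc)
  also have "A ** matrix_inv A = mat 1"
    using matrix_inv_left[OF \<open>invertible A\<close>] matrix_left_right_inverse by blast
  finally show ?thesis by simp
qed

text \<open>The numerator of a linear combination of the differentials in \<open>du\<close>, whose
  \<open>i\<close>-th coordinate carries the power \<open>CARD('n) - idx i\<close>.\<close>

definition vec_poly :: "real^'n::{finite,linorder} \<Rightarrow> real poly" where
  "vec_poly v = (\<Sum>i\<in>UNIV. smult (v $ i) (monom 1 (CARD('n) - idx i)))"

lemma degree_vec_poly: "degree (vec_poly (v :: real^'n::{finite,linorder})) < CARD('n)"
  unfolding vec_poly_def
proof (rule degree_sum_less)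
  fix i :: 'n
  have "CARD('n) - idx i < CARD('n)" using idx_range[of i] by auto
  then show "degree (smult (v $ i) (monom 1 (CARD('n) - idx i))) < CARD('n)"
    using degree_smult_le[of "v $ i" "monom 1 (CARD('n) - idx i)"] degree_monom_le[of "1::real" "CARD('n) - idx i"]
    by linarith
qed simp

lemma coeff_vec_poly: "coeff (vec_poly v) (CARD('n) - idx i) = v $ (i :: 'n::{finite,linorder})"
proof -
  have "CARD('n) - idx j = CARD('n) - idx i \<longleftrightarrow> j = i" for j :: 'n
    using idx_range[of i] idx_range[of j] idx_inj[of j i] by auto
  then show ?thesis
    by (simp add: vec_poly_def coeff_sum if_distrib[of "\<lambda>x. _ * x"] cong: if_cong)
qed

lemma vec_poly_eq_0: "vec_poly v = 0 \<longleftrightarrow> v = 0"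
proof
  assume "vec_poly v = 0"
  then show "v = 0" using coeff_vec_poly[of v] by (simp add: vec_eq_iff)
qed (simp add: vec_poly_def)

text \<open>Rows belong to differentials and columns to cycles. Up to the sign of the branch,
  \<open>cut_matrix\<close> is the matrix of a-periods, and \<open>\<i>\<close> times
  \<open>gap_matrix\<close> that of b-periods; see \<open>periods_as_matrices\<close>.\<close>

definition cut_matrix :: "(nat \<Rightarrow> real) \<Rightarrow> real^'n::{finite,linorder}^'n::{finite,linorder}" where
  "cut_matrix e = (\<chi> n k. branch_points.cut_int CARD('n) e (monom 1 (CARD('n) - idx n)) (idx k))"

definition gap_matrix :: "(nat \<Rightarrow> real) \<Rightarrow> real^'n::{finite,linorder}^'n::{finite,linorder}" where
  "gap_matrix e = (\<chi> n k. \<Sum>i=idx k..CARD('n).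
     branch_points.gap_int CARD('n) e (monom 1 (CARD('n) - idx n)) i)"

context
  fixes e :: "nat \<Rightarrow> real"
  assumes bp: "branch_points CARD('n::{finite,linorder}) e"
begin

interpretation branch_points "CARD('n)" e by (rule bp)

lemma vector_cut_matrix: "(v v* cut_matrix e) $ k = cut_int (vec_poly v) (idx (k :: 'n))"
  by (simp add: vector_matrix_mult_def cut_matrix_def vec_poly_def cut_int_sum cut_int_smult mult.commute)

lemma vector_gap_matrix: "(v v* gap_matrix e) $ k = (\<Sum>i=idx (k :: 'n)..CARD('n). gap_int (vec_poly v) i)"
  by (simp add: vector_matrix_mult_def gap_matrix_def vec_poly_def gap_int_sum gap_int_smult
      sum_distrib_left sum_distrib_right mult.commute sum.swap[of _ UNIV])

lemma vector_cut_matrix_eq_0: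
  assumes "v v* cut_matrix e = (0 :: real^'n::{finite,linorder})" shows "v = 0"
proof -
  have "cut_int (vec_poly v) k = 0" if k: "k \<in> {1..CARD('n)}" for k
  proof -
    obtain i :: 'n where "k = idx i" using idx_surj[OF k] by blast
    then show ?thesis using vector_cut_matrix[of v i] assms by simp
  qed
  then have "vec_poly v = 0" by (intro cut_ints_eq_0 degree_vec_poly)
  then show ?thesis by (simp add: vec_poly_eq_0)
qed

lemma invertible_cut_matrix: "invertible (cut_matrix e :: real^'n::{finite,linorder}^'n::{finite,linorder})"
proof -
  have "\<forall>x. transpose (cut_matrix e :: real^'n::{finite,linorder}^'n::{finite,linorder}) *v x = 0 \<longrightarrow> x = 0"
    using vector_cut_matrix_eq_0 by simp
  then have "invertible (transpose (cut_matrix e :: real^'n::{finite,linorder}^'n::{finite,linorder}))"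
    unfolding invertible_left_inverse matrix_left_invertible_ker .
  then show ?thesis by (metis transpose_invertible transpose_transpose)
qed

text \<open>An injective square linear system is solvable for every right-hand side.\<close>

lemma cut_ints_surj: "\<exists>q. degree q < CARD('n) \<and> (\<forall>k\<in>{1..CARD('n)}. cut_int q k = a k)"
proof -
  define w :: "real^'n::{finite,linorder}" where "w = (\<chi> k. a (idx k))"
  obtain B where B: "B ** (cut_matrix e :: real^'n::{finite,linorder}^'n::{finite,linorder}) = mat 1"
    using invertible_cut_matrix by (auto simp: invertible_def)
  have "(w v* B) v* cut_matrix e = w"
    by (simp add: vector_matrix_mul_assoc B)
  then have *: "cut_int (vec_poly (w v* B)) (idx k) = a (idx k)" for k :: 'n
    using vector_cut_matrix[of "w v* B" k] by (simp add: w_def)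
  have "cut_int (vec_poly (w v* B)) k = a k" if k: "k \<in> {1..CARD('n)}" for k
  proof -
    obtain i :: 'n where "k = idx i" using idx_surj[OF k] by blast
    then show ?thesis using * by simp
  qed
  then show ?thesis using degree_vec_poly by blast
qed

text \<open>With \<open>m = p v* cut_matrix e\<close> the form becomes the product of the a-periods
  and b-periods of the single differential with numerator \<open>vec_poly p\<close>.\<close>

lemma period_matrix_pos_def:
  fixes m :: "real^'n::{finite,linorder}"
  assumes m: "m \<noteq> 0"
  shows "m \<bullet> ((matrix_inv (cut_matrix e) ** gap_matrix e) *v m) > 0"
proof -
  define p where "p = m v* matrix_inv (cut_matrix e :: real^'n::{finite,linorder}^'n::{finite,linorder})"
  have pW: "p v* cut_matrix e = m"
    using matrix_inv_left[OF invertible_cut_matrix] by (simp add: p_def vector_matrix_mul_assoc)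
  then have "p \<noteq> 0" using m by auto
  have "m \<bullet> ((matrix_inv (cut_matrix e) ** gap_matrix e) *v m) = p \<bullet> (gap_matrix e *v m)"
    by (simp add: p_def dot_lmul_matrix matrix_vector_mul_assoc)
  also have "\<dots> = (p v* gap_matrix e) \<bullet> (p v* cut_matrix e)"
    by (simp add: dot_lmul_matrix pW)
  also have "\<dots> = (\<Sum>k\<in>UNIV. (\<lambda>k. cut_int (vec_poly p) k * (\<Sum>i=k..CARD('n). gap_int (vec_poly p) i)) (idx (k :: 'n)))"
    by (simp add: inner_vec_def vector_cut_matrix vector_gap_matrix mult.commute)
  also have "\<dots> = (\<Sum>k=1..CARD('n). cut_int (vec_poly p) k * (\<Sum>i=k..CARD('n). gap_int (vec_poly p) i))"
    by (rule sum_idx)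
  also have "\<dots> > 0"
    using \<open>p \<noteq> 0\<close> by (intro cut_gap_pos cut_ints_surj degree_vec_poly) (simp add: vec_poly_eq_0)
  finally show ?thesis .
qed

end

section \<open>The sigma function\<close>

lemma has_integral_vec_componentwise:
  fixes f :: "real \<Rightarrow> complex^'n"
  assumes "\<And>i. ((\<lambda>x. f x $ i) has_integral v $ i) S"
  shows "(f has_integral v) S"
proof -
  have lin: "bounded_linear (axis i :: complex \<Rightarrow> complex^'n)" for i
    unfolding linear_conv_bounded_linear[symmetric]
    by (rule linearI) (simp_all add: vec_eq_iff axis_def)
  have eq: "(\<Sum>i\<in>UNIV. axis i (w $ i)) = w" for w :: "complex^'n"
    by (simp add: vec_eq_iff axis_def)
  have "((\<lambda>x. \<Sum>i\<in>UNIV. axis i (f x $ i)) has_integral (\<Sum>i\<in>UNIV. axis i (v $ i))) S"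
    using has_integral_linear[OF assms lin] by (intro has_integral_sum) (auto simp: o_def)
  then show ?thesis unfolding eq .
qed

text \<open>\<open>Lambda\<close> is monic of degree \<open>2*g+1\<close> and vanishes at
  \<open>2*g+1\<close> distinct points.\<close>

lemma Lambda_factorization:
  assumes hyp: "real_hyperelliptic g lam e"
  shows "Lambda g lam x = (\<Prod>i\<in>{1..2*g+1}. x - of_real (e i))"
proof -
  define P where "P = monom 1 (2*g+1) + (\<Sum>i=0..2*g. monom (lam (2*i+2)) (2*g-i))"
  have P: "poly P x = Lambda g lam x" for x
    by (simp add: P_def Lambda_def poly_sum poly_monom)
  have deg: "degree (\<Sum>i=0..2*g. monom (lam (2*i+2)) (2*g-i)) < 2*g+1"
    by (intro degree_sum_less) (auto intro: le_less_trans[OF degree_monom_le])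
  have "coeff P (2*g+1) = 1"
    using coeff_eq_0[OF deg] by (simp add: P_def)
  moreover have "degree P \<le> 2*g+1"
    unfolding P_def using deg by (intro degree_add_le degree_monom_le) auto
  moreover have "inj_on (\<lambda>i. complex_of_real (e i)) {1..2*g+1}"
    using hyp strict_mono_on_imp_inj_on[of "{1..2*g+1}" e] by (auto simp: real_hyperelliptic_def inj_on_def)
  moreover have "poly P (of_real (e i)) = 0" if "i \<in> {1..2*g+1}" for i
    using hyp that unfolding P real_hyperelliptic_def by blast
  ultimately have "P = (\<Prod>i\<in>{1..2*g+1}. [:- of_real (e i), 1:])"
    using poly_eq_prod_roots[of "{1..2*g+1}" "\<lambda>i. of_real (e i)" P] by simp
  then have "poly P x = (\<Prod>i\<in>{1..2*g+1}. x - of_real (e i))"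
    by (simp only: poly_prod) simp
  then show ?thesis by (simp only: P)
qed

text \<open>The quotient of \<open>Y\<close> by \<open>root_fun\<close> is continuous on a connected
  set with values in \<open>{1, -1}\<close>, hence a constant sign \<open>s\<close>, which is its
  own inverse.\<close>

lemma (in branch_points) sqrt_branch_boundary:
  assumes hyp: "real_hyperelliptic g lam e" and Y: "sqrt_branch g lam Y"
  obtains s :: real where "s * s = 1"
    "\<And>x. x \<notin> E \<Longrightarrow> 1 / (- 2 * bdry Y x) = - (of_real s / 2) * (1 / root_fun (of_real x))"
proof -
  define H where "H = {z. Im z > 0}"
  have nz: "root_fun z \<noteq> 0" if "z \<in> H" for z using that root_fun_nonzero by (simp add: H_def)
  have sq: "(Y z / root_fun z)\<^sup>2 = 1" if "z \<in> H" for z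
  proof -
    have "(Y z)\<^sup>2 = (root_fun z)\<^sup>2"
      using Y that by (simp add: sqrt_branch_def root_fun_squared Lambda_factorization[OF hyp] H_def J_def)
    then show ?thesis using nz[OF that] by (simp add: power_divide)
  qed
  have sub: "(\<lambda>z. Y z / root_fun z) ` H \<subseteq> {1, -1}"
    using sq by (metis (no_types, lifting) image_subsetI insertCI power2_eq_1_iff)
  have "continuous_on H (\<lambda>z. Y z / root_fun z)"
    using Y nz holomorphic_root_fun
    by (intro continuous_on_divide holomorphic_on_imp_continuous_on) (auto simp: sqrt_branch_def H_def)
  moreover have "connected H"
    unfolding H_def by (intro convex_connected convex_halfspace_Im_gt)
  ultimately have "connected ((\<lambda>z. Y z / root_fun z) ` H)"
    by (rule connected_continuous_image)
  moreover have "finite ((\<lambda>z. Y z / root_fun z) ` H)"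
    using sub by (rule finite_subset) simp
  moreover have "\<i> \<in> H" by (simp add: H_def)
  ultimately obtain c where c: "(\<lambda>z. Y z / root_fun z) ` H = {c}"
    using connected_finite_iff_sing by (metis empty_iff image_is_empty)
  define s :: real where "s = (if c = 1 then 1 else -1)"
  have cs: "c = of_real s" using sub c by (auto simp: s_def)
  have Yeq: "Y z = of_real s * root_fun z" if "z \<in> H" for z
  proof -
    have "Y z / root_fun z = c" using c that by blast
    then show ?thesis using nz[OF that] cs by (simp add: field_simps)
  qed
  have ss: "s * s = 1" by (simp add: s_def)
  show ?thesis
  proof (rule that[OF ss])
    fix x assume x: "x \<notin> E"
    let ?F = "at (complex_of_real x) within H"
    \<comment> \<open>\<open>Lim\<close> in \<open>bdry\<close> is determined by convergence only
      along a nontrivial filter.\<close>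
    have "?F \<noteq> bot"
    proof
      assume "?F = bot"
      then have "filterlim (\<lambda>k. Complex x (1 / real (Suc k))) bot sequentially"
        using filterlim_upper[of x] by (simp add: H_def)
      then show False by (simp add: filterlim_def filtermap_bot_iff bot_unique)
    qed
    moreover have "((\<lambda>z. of_real s * root_fun z) \<longlongrightarrow> of_real s * root_fun (of_real x)) ?F"
      using root_fun_tendsto[OF x] unfolding H_def by (rule tendsto_mult_left)
    then have "(Y \<longlongrightarrow> of_real s * root_fun (of_real x)) ?F"
      by (rule Lim_transform_eventually) (auto simp: eventually_at_filter Yeq)
    ultimately have b: "bdry Y x = of_real s * root_fun (of_real x)"
      unfolding bdry_def H_def by (intro tendsto_Lim)
    have "complex_of_real s * of_real s = 1" using ss by (metis of_real_1 of_real_mult)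
    then show "1 / (- 2 * bdry Y x) = - (of_real s / 2) * (1 / root_fun (of_real x))"
      unfolding b by (cases "root_fun (of_real x) = 0") (auto simp: field_simps s_def)
  qed
qed

text \<open>The factor \<open>-1/2\<close> of the differentials cancels against the factor
  \<open>2\<close> of the periods and the sign of the phases, so only the sign \<open>s\<close> of
  the branch remains.\<close>

lemma periods_as_matrices:
  fixes Y :: "complex \<Rightarrow> complex"
  assumes hyp: "real_hyperelliptic CARD('n::{finite,linorder}) lam e"
    and Y: "sqrt_branch CARD('n) lam Y"
  obtains s :: real where "s * s = 1"
    "\<And>n k :: 'n::{finite,linorder}. omega e Y (idx k) $ n = of_real (s * cut_matrix e $ n $ k)"
    "\<And>n k :: 'n::{finite,linorder}. omega' e Y (idx k) $ n = \<i> * of_real (s * gap_matrix e $ n $ k)"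
proof -
  interpret branch_points "CARD('n)" e
    using hyp by unfold_locales (simp add: real_hyperelliptic_def)
  obtain s :: real where s: "s * s = 1"
    and b: "\<And>x. x \<notin> E \<Longrightarrow> 1 / (- 2 * bdry Y x) = - (of_real s / 2) * (1 / root_fun (of_real x))"
    using sqrt_branch_boundary[OF hyp Y] by metis
  let ?m = "\<lambda>n :: 'n. monom 1 (CARD('n) - idx n) :: real poly"
  have du: "integral {e j..e (j+1)} (du Y) $ n
      = - (of_real s / 2) * ((- \<i>) ^ (2 * CARD('n) + 1 - j) * of_real (wint (?m n) (e j) (e (j+1))))"
    if j: "j \<in> {1..2*CARD('n)}" for j and n :: 'n
  proof -
    define v :: "complex^'n::{finite,linorder}" where "v = (\<chi> n. - (of_real s / 2) *
        ((- \<i>) ^ (2 * CARD('n) + 1 - j) * of_real (wint (?m n) (e j) (e (j+1)))))"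
    have "(du Y has_integral v) {e j..e (j+1)}"
    proof (rule has_integral_vec_componentwise)
      fix n :: 'n
      have "((\<lambda>x. - (of_real s / 2) * bdry_form (?m n) x) has_integral v $ n) (cbox (e j) (e (j+1)))"
        unfolding v_def vec_lambda_beta box_real
        using roots_above_between[OF j]
        by (intro has_integral_mult_right bdry_form_has_integral) auto
      then have "((\<lambda>x. du Y x $ n) has_integral v $ n) (cbox (e j) (e (j+1)))"
      proof (rule has_integral_spike_interior)
        fix x assume "x \<in> box (e j) (e (j+1))"
        then have x: "x \<notin> E" using no_branch_point_between[OF j] by (auto simp: box_real)
        have "du Y x $ n = of_real x ^ (CARD('n) - idx n) * (1 / (- 2 * bdry Y x))"
          by (simp add: du_def)
        also have "\<dots> = - (of_real s / 2) * bdry_form (?m n) x"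
          unfolding b[OF x] inverse_root_fun_real bdry_form_def by (simp add: poly_monom)
        finally show "du Y x $ n = - (of_real s / 2) * bdry_form (?m n) x" .
      qed
      then show "((\<lambda>x. du Y x $ n) has_integral v $ n) {e j..e (j+1)}" by simp
    qed
    then show ?thesis by (simp add: integral_unique v_def)
  qed
  show ?thesis
  proof (rule that[OF s])
    fix n k :: 'n
    have k: "idx k \<in> {1..CARD('n)}" by (rule idx_range)
    have j: "2 * idx k - 1 \<in> {1..2*CARD('n)}" "2 * idx k - 1 + 1 = 2 * idx k" using k by auto
    show "omega e Y (idx k) $ n = of_real (s * cut_matrix e $ n $ k)"
      using du[OF j(1), of n] unfolding j(2) neg_i_power_cut[OF k]
      by (simp add: omega_def cut_matrix_def cut_int_def mult_ac)
    have "2 * (integral {e (2*i)..e (2*i+1)} (du Y) $ n) = \<i> * of_real (s * gap_int (?m n) i)"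
      if i: "i \<in> {idx k..CARD('n)}" for i
    proof -
      have "i \<in> {1..CARD('n)}" "2 * i \<in> {1..2*CARD('n)}" using i k by auto
      then show ?thesis
        using du[of "2*i" n] neg_i_power_gap[of i "CARD('n)"] by (simp add: gap_int_def mult_ac)
    qed
    then show "omega' e Y (idx k) $ n = \<i> * of_real (s * gap_matrix e $ n $ k)"
      by (simp add: omega'_def gap_matrix_def sum_distrib_left)
  qed
qed

section \<open>Reduction of the sigma function to the real theta series\<close>

definition cmat :: "real^'n^'m \<Rightarrow> complex^'n^'m" where
  "cmat A = (\<chi> i j. complex_of_real (A $ i $ j))"

lemma cmat_mult: "cmat A ** cmat B = cmat (A ** B)"
  by (simp add: cmat_def matrix_matrix_mult_def vec_eq_iff)

lemma cmat_mult_imag_vec: "cmat A *v imag_vec t = imag_vec (A *v t)"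
  by (simp add: cmat_def matrix_vector_mult_def vec_eq_iff imag_vec_def sum_distrib_left mult_ac)

lemma imag_vec_add: "imag_vec (a + b) = imag_vec a + imag_vec b"
  by (simp add: imag_vec_def vec_eq_iff distrib_left)

text \<open>The inverse of the a-period matrix thus sends \<open>Omega\<close> to half the indicator
  vector of \<open>I\<close>.\<close>

lemma Omega_eq:
  assumes "I \<subseteq> {1..CARD('n::{finite,linorder})}"
  shows "(Omega e Y I :: complex^'n::{finite,linorder})
    = of_columns (omega e Y) *v ((1/2) *s cvec (\<chi> i. if idx i \<in> I then 1 else 0))"
proof -
  have "(Omega e Y I :: complex^'n::{finite,linorder}) $ n
      = (\<Sum>k=1..CARD('n). if k \<in> I then 1/2 * omega e Y k $ n else 0)" for n
    using assms by (simp add: Omega_def sum.If_cases Int_absorb1)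
  also have "\<dots> n = (\<Sum>i\<in>(UNIV :: 'n set). if idx i \<in> I then 1/2 * omega e Y (idx i) $ n else 0)" for n
    by (rule sum_idx[symmetric])
  finally show ?thesis
    by (auto simp: vec_eq_iff matrix_vector_mult_def of_columns_def cvec_def intro!: sum.cong)
qed

text \<open>Sigma is a theta value times \<open>C\<close> and exponentials, so on
  \<open>U_Im\<close> it vanishes exactly with a theta series whose argument has half-integer real
  part. An equivalence for every \<open>I\<close> gives existence and uniqueness together.\<close>

lemma nonvanishing_iff:
  fixes Y :: "complex \<Rightarrow> complex" and e :: "nat \<Rightarrow> real"
  assumes hyp: "real_hyperelliptic CARD('n::{finite,linorder}) lam e"
    and Y: "sqrt_branch CARD('n) lam Y" and C: "C \<noteq> 0"
    and I: "I \<subseteq> {1..CARD('n)}"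
  shows "(\<forall>u :: complex^'n::{finite,linorder}. u \<in> U_Im e Y I \<longrightarrow> sigma_fun lam e Y C u \<noteq> 0)
    \<longleftrightarrow> I = I_hat CARD('n)"
proof -
  interpret branch_points "CARD('n)" e
    using hyp by unfold_locales (simp add: real_hyperelliptic_def)
  have bp: "branch_points CARD('n) e" by unfold_locales
  obtain s :: real where s: "s * s = 1"
    and om: "\<And>n k :: 'n. omega e Y (idx k) $ n = of_real (s * cut_matrix e $ n $ k)"
    and om': "\<And>n k :: 'n. omega' e Y (idx k) $ n = \<i> * of_real (s * gap_matrix e $ n $ k)"
    using periods_as_matrices[OF hyp Y] by metis
  define V where "V = matrix_inv (cut_matrix e :: real^'n::{finite,linorder}^'n::{finite,linorder})"
  define S where "S = V ** gap_matrix e"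
  have V: "V ** cut_matrix e = mat 1"
    unfolding V_def by (rule matrix_inv_left[OF invertible_cut_matrix[OF bp]])
  have "(s *\<^sub>R V) ** (s *\<^sub>R cut_matrix e) = (s * s) *\<^sub>R (V ** cut_matrix e)"
    by (simp add: vec_eq_iff matrix_matrix_mult_def sum_distrib_left mult_ac)
  then have VW: "(s *\<^sub>R V) ** (s *\<^sub>R cut_matrix e) = mat 1"
    by (simp add: s V)
  have W: "of_columns (omega e Y) = cmat (s *\<^sub>R cut_matrix e :: real^'n::{finite,linorder}^'n::{finite,linorder})"
    by (simp add: vec_eq_iff of_columns_def cmat_def om)
  have VWc: "cmat (s *\<^sub>R V) ** of_columns (omega e Y) = mat 1"
    unfolding W cmat_mult VW by (simp add: cmat_def mat_def vec_eq_iff)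
  then have inv: "matrix_inv (of_columns (omega e Y)) = cmat (s *\<^sub>R V)"
    by (rule matrix_inv_eqI)
  \<comment> \<open>The sign \<open>s\<close> of the branch enters both period matrices and cancels
    here.\<close>
  have T: "tau e Y $ i $ j = \<i> * of_real (S $ i $ j)" for i j :: 'n
  proof -
    have "tau e Y $ i $ j = (\<Sum>k\<in>UNIV. of_real (s * V $ i $ k) * (\<i> * of_real (s * gap_matrix e $ k $ j)))"
      unfolding tau_def inv by (simp add: matrix_matrix_mult_def of_columns_def om' cmat_def)
    also have "\<dots> = (\<Sum>k\<in>UNIV. \<i> * of_real ((s * s) * (V $ i $ k * gap_matrix e $ k $ j)))"
      by (intro sum.cong) (simp_all add: mult_ac)
    also have "\<dots> = \<i> * of_real (S $ i $ j)"
      by (simp only: s) (simp add: S_def matrix_matrix_mult_def sum_distrib_left)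
    finally show ?thesis .
  qed
  have pd: "m \<bullet> (S *v m) > 0" if "m \<noteq> 0" for m
    using period_matrix_pos_def[OF bp that] by (simp add: S_def V_def)
  \<comment> \<open>Twice the real part of the theta argument: the indicator of \<open>I\<close>
    comes from \<open>Omega\<close>, the rest from the characteristic.\<close>
  define d :: "int^'n::{finite,linorder}" where "d = (\<chi> i. (if idx i \<in> I then 1 else 0) + K_char $ i)"
  define h :: "real^'n::{finite,linorder}" where "h = (\<chi> i. 1 / 2)"
  \<comment> \<open>All entries of \<open>K_char'\<close> are \<open>1\<close>, so this part of the
    characteristic is a purely imaginary shift, to be absorbed into \<open>r\<close>.\<close>
  have Th: "tau e Y *v ((1/2) *s cvec K_char') = imag_vec (S *v h)"
    by (simp add: vec_eq_iff matrix_vector_mult_def T cvec_def K_char'_nth imag_vec_def h_def sum_distrib_left mult_ac)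
  have zero: "sigma_fun lam e Y C (Omega e Y I + imag_vec t) \<noteq> 0
      \<longleftrightarrow> theta ((1/2) *s cvec d + imag_vec ((s *\<^sub>R V) *v t + S *v h)) (tau e Y) \<noteq> 0" for t :: "real^'n::{finite,linorder}"
  proof -
    have v: "matrix_inv (of_columns (omega e Y)) *v (Omega e Y I + imag_vec t)
        = (1/2) *s cvec (\<chi> i. if idx i \<in> I then 1 else 0) + imag_vec ((s *\<^sub>R V) *v t)"
      unfolding inv Omega_eq[OF I]
      by (simp only: matrix_vector_right_distrib matrix_vector_mul_assoc VWc matrix_vector_mul_lid cmat_mult_imag_vec)
    have arg: "(1/2) *s cvec (\<chi> i. if idx i \<in> I then 1 else 0) + imag_vec ((s *\<^sub>R V) *v t)
        + (1/2) *s cvec K_char + tau e Y *v ((1/2) *s cvec K_char')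
      = (1/2) *s cvec d + imag_vec ((s *\<^sub>R V) *v t + S *v h)"
      unfolding Th imag_vec_add by (simp add: vec_eq_iff cvec_def d_def algebra_simps)
    show ?thesis
      unfolding sigma_fun_def theta_char_def v Let_def arg using C by simp
  qed
  have "(\<forall>u :: complex^'n::{finite,linorder}. u \<in> U_Im e Y I \<longrightarrow> sigma_fun lam e Y C u \<noteq> 0)
      \<longleftrightarrow> (\<forall>t. theta ((1/2) *s cvec d + imag_vec ((s *\<^sub>R V) *v t + S *v h)) (tau e Y) \<noteq> 0)"
    using zero by (auto simp: U_Im_def)
  also have "\<dots> \<longleftrightarrow> (\<forall>r. theta ((1/2) *s cvec d + imag_vec r) (tau e Y) \<noteq> 0)"
  proof (intro iffI allI)
    fix r :: "real^'n::{finite,linorder}"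
    assume *: "\<forall>t. theta ((1/2) *s cvec d + imag_vec ((s *\<^sub>R V) *v t + S *v h)) (tau e Y) \<noteq> 0"
    \<comment> \<open>Every \<open>r\<close> is reached by some \<open>t\<close>, as the a-period
      matrix is invertible.\<close>
    have "(s *\<^sub>R V) *v ((s *\<^sub>R cut_matrix e) *v (r - S *v h)) + S *v h = r"
      by (simp only: matrix_vector_mul_assoc VW matrix_vector_mul_lid diff_add_cancel)
    with *[rule_format, of "(s *\<^sub>R cut_matrix e) *v (r - S *v h)"]
    show "theta ((1/2) *s cvec d + imag_vec r) (tau e Y) \<noteq> 0" by simp
  qed blast
  also have "\<dots> \<longleftrightarrow> (\<forall>i. even (d $ i))"
    using T pd by (rule theta_half_integer_nonvanishing_iff)
  also have "\<dots> \<longleftrightarrow> (\<forall>i :: 'n. idx i \<in> I \<longleftrightarrow> odd (CARD('n) - idx i + 1))"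
  proof -
    have "even (d $ i) \<longleftrightarrow> (idx i \<in> I \<longleftrightarrow> odd (CARD('n) - idx i + 1))" for i :: 'n
      by (simp add: d_def K_char_nth)
    then show ?thesis by simp
  qed
  also have "\<dots> \<longleftrightarrow> (\<forall>k\<in>{1..CARD('n)}. k \<in> I \<longleftrightarrow> odd (CARD('n) - k + 1))"
    by (rule all_idx_iff)
  \<comment> \<open>Both conditions say that \<open>k\<close> has the parity of the genus.\<close>
  also have "\<dots> \<longleftrightarrow> (\<forall>k\<in>{1..CARD('n)}. k \<in> I \<longleftrightarrow> k \<in> I_hat CARD('n))"
    by (intro ball_cong refl arg_cong2[where f = "(=)"]) (auto simp: I_hat_def)
  also have "\<dots> \<longleftrightarrow> I = I_hat CARD('n)"
    using I by (auto simp: I_hat_def split: if_splits)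
  finally show ?thesis .
qed

theorem proposition3:
  fixes lam :: "nat \<Rightarrow> complex" and e :: "nat \<Rightarrow> real" and Y :: "complex \<Rightarrow> complex" and C :: complex
  assumes "real_hyperelliptic CARD('n::{finite,linorder}) lam e"
    and "sqrt_branch CARD('n) lam Y"
    and "C \<noteq> 0"
  shows "(\<exists>!I. I \<subseteq> {1..CARD('n)} \<and>
            (\<forall>u :: complex^'n::{finite,linorder}. u \<in> U_Im e Y I \<longrightarrow> sigma_fun lam e Y C u \<noteq> 0))
    \<and> (\<forall>u :: complex^'n::{finite,linorder}. u \<in> U_Im e Y (I_hat CARD('n)) \<longrightarrow> sigma_fun lam e Y C u \<noteq> 0)
    \<and> (\<forall>m. CARD('n) = 2 * m \<longrightarrow>
          (Omega e Y (I_hat CARD('n)) :: complex^'n::{finite,linorder})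
            = (\<Sum>k=1..m. (1/2) *s omega e Y (2*k)))
    \<and> (\<forall>m. CARD('n) = 2 * m - 1 \<longrightarrow>
          (Omega e Y (I_hat CARD('n)) :: complex^'n::{finite,linorder})
            = (\<Sum>k=1..m. (1/2) *s omega e Y (2*k-1)))
    \<and> (\<forall>u :: complex^'n::{finite,linorder}. u \<in> U_Im e Y (I_hat CARD('n)) \<longrightarrow>
          (\<exists>s. u = imag_vec s + Omega e Y (I_hat CARD('n))))"
proof (intro conjI allI impI)
  have sub: "I_hat CARD('n) \<subseteq> {1..CARD('n)}" by (auto simp: I_hat_def)
  note iff = nonvanishing_iff[OF assms]
  show "\<exists>!I. I \<subseteq> {1..CARD('n)} \<and>
      (\<forall>u :: complex^'n::{finite,linorder}. u \<in> U_Im e Y I \<longrightarrow> sigma_fun lam e Y C u \<noteq> 0)"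
    using iff sub by (intro ex1I[of _ "I_hat CARD('n)"]) blast+
  show "sigma_fun lam e Y C u \<noteq> 0" if "u \<in> U_Im e Y (I_hat CARD('n))" for u :: "complex^'n::{finite,linorder}"
    using iff[OF sub] that by blast
  fix m
  show "(Omega e Y (I_hat CARD('n)) :: complex^'n::{finite,linorder}) = (\<Sum>k=1..m. (1/2) *s omega e Y (2*k))"
    if g: "CARD('n) = 2 * m"
  proof -
    have "I_hat CARD('n) = (\<lambda>k. 2 * k) ` {1..m}"
      unfolding g by (auto simp: I_hat_def elim!: evenE)
    then show ?thesis by (simp add: Omega_def sum.reindex inj_on_def)
  qed
  show "(Omega e Y (I_hat CARD('n)) :: complex^'n::{finite,linorder}) = (\<Sum>k=1..m. (1/2) *s omega e Y (2*k-1))"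
    if g: "CARD('n) = 2 * m - 1"
  proof -
    have "CARD('n) > 0" by simp
    \<comment> \<open>For \<open>m = 0\<close> truncated subtraction would make
      \<open>2 * m - 1\<close> equal to \<open>0\<close>, which a positive genus rules out.\<close>
    then have "m \<ge> 1" using g by linarith
    then have "I_hat CARD('n) = {k \<in> {1..2*m-1}. odd k}"
      unfolding g by (simp add: I_hat_def)
    also have "\<dots> = (\<lambda>k. 2 * k - 1) ` {1..m}"
    proof (intro equalityI subsetI)
      fix k assume "k \<in> {k \<in> {1..2*m-1}. odd k}"
      then have "k = 2 * ((k + 1) div 2) - 1" "(k + 1) div 2 \<in> {1..m}" by auto
      then show "k \<in> (\<lambda>k. 2 * k - 1) ` {1..m}" by (rule image_eqI)
    qed auto
    finally have "I_hat CARD('n) = (\<lambda>k. 2 * k - 1) ` {1..m}" .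
    moreover have "inj_on (\<lambda>k::nat. 2 * k - 1) {1..m}"
      by (rule inj_onI) auto
    ultimately show ?thesis by (simp add: Omega_def sum.reindex)
  qed
  show "\<exists>s. u = imag_vec s + Omega e Y (I_hat CARD('n))"
    if "u \<in> U_Im e Y (I_hat CARD('n))" for u :: "complex^'n::{finite,linorder}"
    using that by (auto simp: U_Im_def add.commute)
qed

end
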